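(* Suppose that $2<p\leq\infty$ and $d\ge 1$, and let $c_1,\ldots,c_d\in\mathbb{C}$. If $\varphi(z)=\sum_{j=1}^d c_j z_j$ is a Hilbert point in $H^p(\mathbb{T}^d)$, then the nonzero coefficients among $c_1,\ldots,c_d$ all have the same modulus.
   Context: $\mathbb{T}^d$ is the $d$-dimensional torus with normalized Haar measure $m_d$; $\widehat f(\alpha)=\int_{\mathbb{T}^d} f(z)\overline{z^\alpha}\,dm_d(z)$ for $\alpha\in\mathbb{Z}^d$. The Hardy space $H^p(\mathbb{T}^d)$ is the closed subspace of $L^p(\mathbb{T}^d)$ of functions $f$ with $\widehat f(\alpha)=0$ for all $\alpha\in\mathbb{Z}^d\setminus\mathbb{N}_0^d$, $\mathbb{N}_0=\{0,1,2,\ldots\}$, with the $L^p$ norm $\|\cdot\|_{H^p(\mathbb{T}^d)}$. Write $\langle f,g\rangle=\int_{\mathbb{T}^d} f\overline g\,dm_d$. For $2< p\le\infty$, a nontrivial (i.e. not a.e. zero) function $\varphi$ in $H^p(\mathbb{T}^d)$ is a Hilbert point in $H^p(\mathbb{T}^d)$ if $\|\varphi\|_{H^p(\mathbb{T}^d)}\le\|\varphi+f\|_{H^p(\mathbb{T}^d)}$ for every $f\in H^p(\mathbb{T}^d)$ such that $\langle f,\varphi\rangle=0$. *)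

theory Defs
  imports "HOL-Probability.Probability"
begin

definition circle_measure :: "complex measure" where
  "circle_measure =
     distr (uniform_measure lborel {0..1::real}) (restrict_space borel (sphere 0 1))
       (\<lambda>t. cis (2 * pi * t))"

text \<open>Points of the \<open>d\<close>-torus are functions on the index set \<open>{1..d}\<close> (extended by
  \<^const>\<open>undefined\<close> elsewhere) with values on the unit circle.\<close>

definition torus :: "nat \<Rightarrow> (nat \<Rightarrow> complex) measure" where
  "torus d = PiM {1..d} (\<lambda>_. circle_measure)"

lemma prob_space_circle_measure: "prob_space circle_measure"
proof -
  have "(\<lambda>t::real. cis (2 * pi * t)) \<in> borel_measurable borel"
    by (intro borel_measurable_continuous_onI continuous_intros)
  then have "(\<lambda>t. cis (2 * pi * t)) \<in> 
      uniform_measure lborel {0..1::real} \<rightarrow>\<^sub>M restrict_space borel (sphere 0 1)"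
    by (intro measurable_restrict_space2) auto
  moreover have "prob_space (uniform_measure lborel {0..1::real})"
    by (rule prob_space_uniform_measure) auto
  ultimately show ?thesis
    unfolding circle_measure_def by (rule prob_space.prob_space_distr[rotated])
qed

lemma prob_space_torus: "prob_space (torus d)"
  unfolding torus_def by (intro prob_space_PiM prob_space_circle_measure)

lemma space_torus: "space (torus d) = {1..d} \<rightarrow>\<^sub>E sphere 0 1"
  by (simp add: torus_def circle_measure_def space_PiM space_restrict_space)

definition fourier_coeff :: "nat \<Rightarrow> ((nat \<Rightarrow> complex) \<Rightarrow> complex) \<Rightarrow> (nat \<Rightarrow> int) \<Rightarrow> complex" where
  "fourier_coeff d f \<alpha> = (LINT z|torus d. f z * cnj (\<Prod>j = 1..d. z j powi \<alpha> j))"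

text \<open>Elements of the Lebesgue spaces are represented by functions rather than by classes modulo
  null sets; \<open>p = \<infinity>\<close> is allowed. The definitions are meant for \<open>1 \<le> p\<close>, and the norm is
  meaningful only for members of the corresponding space.\<close>

definition Lp_space :: "'a measure \<Rightarrow> ereal \<Rightarrow> ('a \<Rightarrow> complex) set" where
  "Lp_space M p =
     {f \<in> borel_measurable M.
        if p = \<infinity> then \<exists>C. AE x in M. cmod (f x) \<le> C
        else integrable M (\<lambda>x. cmod (f x) powr real_of_ereal p)}"

definition Lp_norm :: "'a measure \<Rightarrow> ereal \<Rightarrow> ('a \<Rightarrow> complex) \<Rightarrow> real" where
  "Lp_norm M p f =
     (if p = \<infinity> then real_of_ereal (esssup M (\<lambda>x. ereal (cmod (f x))))
      else (LINT x|M. cmod (f x) powr real_of_ereal p) powr (1 / real_of_ereal p))"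

definition hardy_space :: "nat \<Rightarrow> ereal \<Rightarrow> ((nat \<Rightarrow> complex) \<Rightarrow> complex) set" where
  "hardy_space d p =
     {f \<in> Lp_space (torus d) p. \<forall>\<alpha>. (\<exists>j\<in>{1..d}. \<alpha> j < 0) \<longrightarrow> fourier_coeff d f \<alpha> = 0}"

definition torus_inner ::
    "nat \<Rightarrow> ((nat \<Rightarrow> complex) \<Rightarrow> complex) \<Rightarrow> ((nat \<Rightarrow> complex) \<Rightarrow> complex) \<Rightarrow> complex" where
  "torus_inner d f g = (LINT z|torus d. f z * cnj (g z))"

text \<open>Intended for \<open>2 < p\<close>, where the integral defining the inner product converges.\<close>

definition hilbert_point :: "nat \<Rightarrow> ereal \<Rightarrow> ((nat \<Rightarrow> complex) \<Rightarrow> complex) \<Rightarrow> bool" where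
  "hilbert_point d p \<phi> \<longleftrightarrow>
     \<phi> \<in> hardy_space d p \<and> \<not> (AE z in torus d. \<phi> z = 0) \<and>
     (\<forall>f\<in>hardy_space d p. torus_inner d f \<phi> = 0 \<longrightarrow>
        Lp_norm (torus d) p \<phi> \<le> Lp_norm (torus d) p (\<lambda>z. \<phi> z + f z))"

end

theory Submission
  imports Defs
begin

text \<open>Suppose that \<open>a = |c\<^sub>j| > b = |c\<^sub>k| > 0\<close>. For \<open>p = \<infinity>\<close> the norm of the form is the sum of the moduli of its
  coefficients, and an admissible perturbation makes this sum smaller. For \<open>p < \<infinity>\<close> put \<open>q = p/2\<close>. By rotation
  invariance, the mean of \<open>|x z\<^sub>j + y z\<^sub>k + w|\<^sup>p\<close> over \<open>z\<^sub>j, z\<^sub>k\<close> is the mean over \<open>\<alpha>\<close> of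
  \<open>M (|x|\<^sup>2 + |y|\<^sup>2 + 2 |x| |y| cos \<alpha>)\<close>, where \<open>M s\<close> is the mean of \<open>|w + \<surd>s z|\<^sup>p\<close> over the unit circle.
  The bilaplacian of \<open>|x|\<^sup>p\<close> is positive for \<open>p > 2\<close>, which makes \<open>M\<close> strictly convex. Hence, for fixed
  \<open>|x|\<^sup>2 + |y|\<^sup>2\<close>, the mean is a convex function of \<open>|x| |y|\<close> that is strictly above its value at 0, and
  rotating \<open>(a, b)\<close> by a small angle away from the diagonal lowers the \<open>p\<close>-th moment to first order. Such a rotation
  changes the inner product with the form only to second order, so after rescaling it contradicts the
  Hilbert point property.\<close>

section \<open>Circular means of radial functions\<close>

text \<open>Why a nonnegative bilaplacian forces convexity in \<open>s\<close>: the slope of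
  \<open>M\<close> is the average over \<open>[0, s]\<close> of the circular mean \<open>N\<close>
  of a quarter of the Laplacian. The same step applied to \<open>N\<close> shows that
  \<open>s\<close> times its slope is the integral of a nonnegative function, so \<open>N\<close>
  increases, and the running average of an increasing function increases. At exponent 2 the
  bilaplacian vanishes, \<open>M s = r\<^sup>2 + s\<close> is affine, and nothing is gained. The
  obstacle is that strictness must be quantitative and uniform: the gain is integrated over the
  remaining variables, which enter through \<open>r = |w|\<close>, and it must survive the removal
  of a smoothing at the origin. Convexity of \<open>M\<close> minus a fixed multiple of a power of
  \<open>s\<close> provides both. With \<open>a\<^sup>2 + b\<^sup>2\<close> fixed, a rotation by
  \<open>t\<close> lowers \<open>a b\<close> at the rate \<open>a\<^sup>2 - b\<^sup>2\<close>, which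
  is where unequal moduli enter. Convexity between \<open>0\<close> and \<open>k\<close> converts
  this into a drop of the moment proportional to \<open>1 - k' / k\<close>, in place of a derivative
  in \<open>k\<close>.\<close>

text \<open>In the variable \<open>s = |x|\<^sup>2\<close> the Laplacian of a radial function is \<open>4 d/ds (s d/ds)\<close>. The hypotheses
  therefore express that \<open>M\<close>, as a radial function, has the nonnegative bilaplacian \<open>16 l\<close>.\<close>

lemma convex_on_of_iterated_euler_derivatives:
  fixes M P N Q l :: "real \<Rightarrow> real"
  assumes M: "\<And>s. 0 < s \<Longrightarrow> s < S \<Longrightarrow> (M has_real_derivative P s / s) (at s)"
    and P: "\<And>s. 0 < s \<Longrightarrow> s < S \<Longrightarrow> (P has_real_derivative N s) (at s)"
    and N: "\<And>s. 0 < s \<Longrightarrow> s < S \<Longrightarrow> (N has_real_derivative Q s / s) (at s)"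
    and Q: "\<And>s. 0 < s \<Longrightarrow> s < S \<Longrightarrow> (Q has_real_derivative l s) (at s)"
    and l: "\<And>s. 0 < s \<Longrightarrow> s < S \<Longrightarrow> 0 \<le> l s"
    and cont: "continuous_on {0..<S} P" "continuous_on {0..<S} Q"
    and zero: "P 0 = 0" "Q 0 = 0"
  shows "convex_on {0<..<S} M"
proof -
  have Q0: "0 \<le> Q s" if "0 < s" "s < S" for s
  proof -
    have "Q 0 \<le> Q s"
    proof (rule DERIV_nonneg_imp_increasing_open[of 0 s Q])
      show "continuous_on {0..s} Q"
        by (rule continuous_on_subset[OF cont(2)]) (use that in auto)
    qed (use that in \<open>auto intro!: exI conjI Q l\<close>)
    then show ?thesis by (simp add: zero)
  qed
  have N_mono: "N x \<le> N y" if "0 < x" "x \<le> y" "y < S" for x y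
    by (rule DERIV_nonneg_imp_nondecreasing[of x y N])
      (use that in \<open>auto intro!: exI conjI N divide_nonneg_pos Q0\<close>)
  \<comment> \<open>The averaging step: by the mean value theorem \<open>P s\<close> is
    \<open>s\<close> times a value of \<open>N\<close> at an earlier point. It makes the derivative
    of \<open>P s / s\<close> nonnegative.\<close>
  have P_le: "P s \<le> s * N s" if s: "0 < s" "s < S" for s
  proof -
    obtain z where z: "0 < z" "z < s" "P s - P 0 = (s - 0) * N z"
    proof -
      have "continuous_on {0..s} P"
        by (rule continuous_on_subset[OF cont(1)]) (use s in auto)
      moreover have "\<And>x. 0 < x \<Longrightarrow> x < s \<Longrightarrow> (P has_real_derivative N x) (at x)"
        using P s by auto
      ultimately have "\<exists>z>0. z < s \<and> P s - P 0 = (s - 0) * N z"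
        using MVT[of 0 s P] s
        by (metis DERIV_unique real_differentiable_def)
      then show ?thesis using that by auto
    qed
    then show ?thesis using N_mono[of z s] s zero by (auto intro: mult_left_mono)
  qed
  show ?thesis
  proof (rule convex_on_realI[where f' = "\<lambda>s. P s / s"])
    fix x y assume xy: "x \<in> {0<..<S}" "y \<in> {0<..<S}" "x \<le> y"
    show "P x / x \<le> P y / y"
    proof (rule DERIV_nonneg_imp_nondecreasing[of x y "\<lambda>s. P s / s", OF xy(3)])
      fix s assume s: "x \<le> s" "s \<le> y"
      then have s0: "0 < s" "s < S" using xy by auto
      have "((\<lambda>s. P s / s) has_real_derivative (N s * s - P s * 1) / (s * s)) (at s)"
        by (rule derivative_intros P s0)+ (use s0 in auto)
      moreover have "0 \<le> (N s * s - P s * 1) / (s * s)"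
        using P_le[OF s0] s0 by (simp add: mult.commute)
      ultimately show "\<exists>d. ((\<lambda>s. P s / s) has_real_derivative d) (at s) \<and> 0 \<le> d" by blast
    qed
  qed (use M in auto)
qed

text \<open>\<open>chord r s t\<close> is \<open>|r + \<surd>s exp (2\<pi>it)|\<^sup>2\<close>, so \<open>circle_mean f\<close> averages \<open>f(|x|\<^sup>2)\<close> over a circle of
  squared radius \<open>s\<close>, and \<open>circle_flux f'\<close> is \<open>s\<close> times its derivative in \<open>s\<close>.\<close>

definition chord :: "real \<Rightarrow> real \<Rightarrow> real \<Rightarrow> real" where
  "chord r s t = r\<^sup>2 + s + 2 * r * sqrt s * cos (2 * pi * t)"

definition circle_mean :: "(real \<Rightarrow> real) \<Rightarrow> real \<Rightarrow> real \<Rightarrow> real" where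
  "circle_mean f r s = integral {0..1} (\<lambda>t. f (chord r s t))"

definition circle_flux :: "(real \<Rightarrow> real) \<Rightarrow> real \<Rightarrow> real \<Rightarrow> real" where
  "circle_flux f' r s = integral {0..1} (\<lambda>t. f' (chord r s t) * (s + r * sqrt s * cos (2 * pi * t)))"

lemma chord_nonneg: "0 \<le> s \<Longrightarrow> 0 \<le> chord r s t"
proof -
  assume s: "0 \<le> s"
  have "chord r s t = (sqrt s + r * cos (2 * pi * t))\<^sup>2 + (r * sin (2 * pi * t))\<^sup>2"
    using s sin_cos_squared_add[of "2 * pi * t"]
    by (simp add: chord_def power2_sum power_mult_distrib sin_squared_eq algebra_simps)
  then show ?thesis by simp
qed

lemma chord_le:
  assumes "0 \<le> r" "0 \<le> s" shows "chord r s t \<le> (r + sqrt s)\<^sup>2"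
proof -
  have "r * sqrt s * cos (2 * pi * t) \<le> r * sqrt s * 1"
    by (intro mult_left_mono) (use assms in auto)
  then show ?thesis using assms by (simp add: chord_def power2_sum)
qed

lemma continuous_on_chord [continuous_intros]:
  fixes g h :: "'a::t2_space \<Rightarrow> real"
  assumes "continuous_on A g" "continuous_on A h"
  shows "continuous_on A (\<lambda>x. chord r (g x) (h x))"
  unfolding chord_def by (intro continuous_intros assms)

lemma continuous_on_chord_compose:
  fixes f :: "real \<Rightarrow> real" and g h :: "'a::t2_space \<Rightarrow> real"
  assumes f: "continuous_on {0..} f" and g: "continuous_on A g" and h: "continuous_on A h"
    and pos: "\<And>x. x \<in> A \<Longrightarrow> 0 \<le> g x"
  shows "continuous_on A (\<lambda>x. f (chord r (g x) (h x)))"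
proof (rule continuous_on_compose2[OF f])
  show "continuous_on A (\<lambda>x. chord r (g x) (h x))" by (intro continuous_intros g h)
qed (use pos chord_nonneg in auto)

lemma continuous_on_circle_mean:
  assumes "continuous_on {0..} f"
  shows "continuous_on {0..} (circle_mean f r)"
  unfolding circle_mean_def interval_cbox
  by (rule integral_continuous_on_param)
    (unfold split_def, intro continuous_on_chord_compose[OF assms] continuous_intros, auto)

lemma continuous_on_circle_flux:
  assumes "continuous_on {0..} f"
  shows "continuous_on {0..} (circle_flux f r)"
  unfolding circle_flux_def interval_cbox
  by (rule integral_continuous_on_param)
    (unfold split_def, intro continuous_on_chord_compose[OF assms] continuous_intros, auto)

lemma circle_flux_0 [simp]: "circle_flux f r 0 = 0"
  by (simp add: circle_flux_def)

lemma DERIV_chord: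
  assumes "0 < s"
  shows "((\<lambda>s. chord r s t) has_real_derivative (1 + r * cos (2 * pi * t) / sqrt s)) (at s within A)"
  unfolding chord_def using assms
  by (auto intro!: derivative_eq_intros simp: field_simps)

text \<open>The \<open>s\<close>-derivative of \<open>chord\<close> is the weight in
  \<open>circle_flux\<close> divided by \<open>s\<close>. Differentiation under the integral takes
  place on the open half-line, away from the singularity of \<open>sqrt\<close> at 0.\<close>

lemma DERIV_circle_mean:
  assumes f: "\<And>u. 0 \<le> u \<Longrightarrow> (f has_real_derivative f1 u) (at u)"
    and f1: "continuous_on {0..} f1" and s: "0 < s"
  shows "(circle_mean f r has_real_derivative circle_flux f1 r s / s) (at s)"
proof -
  have cf: "continuous_on {0..} f"
    by (rule DERIV_continuous_on[where D=f1]) (use f in \<open>auto intro: has_field_derivative_at_within\<close>)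
  have "((\<lambda>s. integral (cbox 0 1) (\<lambda>t. f (chord r s t))) has_field_derivative
      integral (cbox 0 1) (\<lambda>t. f1 (chord r s t) * (1 + r * cos (2 * pi * t) / sqrt s)))
      (at s within {0<..})"
  proof (rule leibniz_rule_field_derivative[where U = "{0<..}"])
    fix x t :: real assume "x \<in> {0<..}"
    then have x: "0 < x" by simp
    show "((\<lambda>s. f (chord r s t)) has_real_derivative
        f1 (chord r x t) * (1 + r * cos (2 * pi * t) / sqrt x)) (at x within {0<..})"
      by (rule DERIV_chain2[OF f DERIV_chord[OF x]]) (use x in \<open>auto intro: chord_nonneg\<close>)
  next
    fix x :: real assume "x \<in> {0<..}"
    then show "(\<lambda>t. f (chord r x t)) integrable_on cbox 0 1"
      by (intro integrable_continuous continuous_on_chord_compose[OF cf] continuous_intros) auto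
  next
    show "continuous_on ({0<..} \<times> cbox 0 1)
        (\<lambda>(x, t). f1 (chord r x t) * (1 + r * cos (2 * pi * t) / sqrt x))"
      unfolding split_def
      by (intro continuous_intros continuous_on_chord_compose[OF f1]) auto
  qed (use s in auto)
  moreover have "integral (cbox 0 1) (\<lambda>t. f1 (chord r s t) * (1 + r * cos (2 * pi * t) / sqrt s))
      = circle_flux f1 r s / s"
  proof -
    have "f1 (chord r s t) * (1 + r * cos (2 * pi * t) / sqrt s) =
       (1 / s) * (f1 (chord r s t) * (s + r * sqrt s * cos (2 * pi * t)))" for t
    proof -
      have "1 + r * cos (2 * pi * t) / sqrt s = (1 / s) * (s + r * sqrt s * cos (2 * pi * t))"
      proof -
        define y where "y = sqrt s"
        have "0 < y" "s = y\<^sup>2" using s by (auto simp: y_def)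
        then show ?thesis
          unfolding y_def[symmetric] by (simp add: field_simps power2_eq_square)
      qed
      then show ?thesis by (metis mult.left_commute)
    qed
    then show ?thesis by (simp add: circle_flux_def)
  qed
  ultimately show ?thesis
    using s by (simp add: circle_mean_def[abs_def] at_within_open[of s "{0<..}"])
qed

text \<open>The \<open>s\<close>-derivative of the integrand of the flux and the integrand on the right differ by an exact
  derivative in \<open>t\<close>: in polar coordinates,
  \<open>(\<rho> \<partial>\<^sub>\<rho>)\<^sup>2 + \<partial>\<^sub>\<theta>\<^sup>2\<close> is \<open>\<rho>\<^sup>2\<close> times the Laplacian,
  and the angular part integrates to zero over the circle.\<close>

lemma DERIV_circle_flux:
  assumes f1: "\<And>u. 0 \<le> u \<Longrightarrow> (f1 has_real_derivative f2 u) (at u)"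
    and f2: "continuous_on {0..} f2" and s: "0 < s"
  shows "(circle_flux f1 r has_real_derivative circle_mean (\<lambda>u. u * f2 u + f1 u) r s) (at s)"
proof -
  have cf: "continuous_on {0..} f1"
    by (rule DERIV_continuous_on[where D=f2]) (use f1 in \<open>auto intro: has_field_derivative_at_within\<close>)
  define D where "D = (\<lambda>s t. f2 (chord r s t) * (1 + r * cos (2 * pi * t) / sqrt s) *
         (s + r * sqrt s * cos (2 * pi * t))
       + (1 + r * cos (2 * pi * t) / (2 * sqrt s)) * f1 (chord r s t))"
  have "((\<lambda>s. integral (cbox 0 1) (\<lambda>t. f1 (chord r s t) * (s + r * sqrt s * cos (2 * pi * t))))
      has_field_derivative integral (cbox 0 1) (D s)) (at s within {0<..})"
  proof (rule leibniz_rule_field_derivative[where U = "{0<..}"])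
    fix x t :: real assume "x \<in> {0<..}"
    then have x: "0 < x" by simp
    have "((\<lambda>s. f1 (chord r s t)) has_real_derivative
        f2 (chord r x t) * (1 + r * cos (2 * pi * t) / sqrt x)) (at x within {0<..})"
      by (rule DERIV_chain2[OF f1 DERIV_chord[OF x]]) (use x in \<open>auto intro: chord_nonneg\<close>)
    moreover have "((\<lambda>s. s + r * sqrt s * cos (2 * pi * t)) has_real_derivative
        (1 + r * cos (2 * pi * t) / (2 * sqrt x))) (at x within {0<..})"
      using x by (auto intro!: derivative_eq_intros simp: field_simps)
    ultimately show "((\<lambda>s. f1 (chord r s t) * (s + r * sqrt s * cos (2 * pi * t))) has_real_derivative
        D x t) (at x within {0<..})"
      unfolding D_def by (rule DERIV_mult)
  next
    fix x :: real assume "x \<in> {0<..}"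
    then show "(\<lambda>t. f1 (chord r x t) * (x + r * sqrt x * cos (2 * pi * t))) integrable_on cbox 0 1"
      by (intro integrable_continuous continuous_on_chord_compose[OF cf] continuous_intros) auto
  next
    show "continuous_on ({0<..} \<times> cbox 0 1) (\<lambda>(x, t). D x t)"
      unfolding split_def D_def
      by (intro continuous_intros continuous_on_chord_compose[OF cf] continuous_on_chord_compose[OF f2]) auto
  qed (use s in auto)
  moreover have "integral (cbox 0 1) (D s) = circle_mean (\<lambda>u. u * f2 u + f1 u) r s"
  proof -
    \<comment> \<open>If \<open>f1\<close> is the derivative of \<open>f\<close>, then
      \<open>?h\<close> is the \<open>t\<close>-derivative of \<open>f (chord r s t)\<close> times
      \<open>-1 / (16 pi^2 s)\<close>. It vanishes at both endpoints.\<close>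
    let ?h = "\<lambda>t. r * sin (2 * pi * t) * f1 (chord r s t) / (4 * pi * sqrt s)"
    let ?L = "\<lambda>t. chord r s t * f2 (chord r s t) + f1 (chord r s t)"
    have "((\<lambda>t. D s t - ?L t) has_integral (?h 1 - ?h 0)) {0..1}"
    proof (rule fundamental_theorem_of_calculus)
      fix t :: real
      have 1: "((\<lambda>t. f1 (chord r s t)) has_real_derivative
          f2 (chord r s t) * (- 2 * r * sqrt s * (2 * pi) * sin (2 * pi * t))) (at t within {0..1})"
      proof (rule DERIV_chain2[OF f1])
        show "0 \<le> chord r s t" using s by (simp add: chord_nonneg)
        show "(chord r s has_real_derivative - 2 * r * sqrt s * (2 * pi) * sin (2 * pi * t)) (at t within {0..1})"
          unfolding chord_def by (auto intro!: derivative_eq_intros)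
      qed
      have 2: "((\<lambda>t. r * sin (2 * pi * t)) has_real_derivative r * (cos (2 * pi * t) * (2 * pi))) (at t within {0..1})"
        by (auto intro!: derivative_eq_intros)
      have "(?h has_real_derivative (r * sin (2 * pi * t) * (f2 (chord r s t) * (- 2 * r * sqrt s * (2 * pi) * sin (2 * pi * t)))
          + r * (cos (2 * pi * t) * (2 * pi)) * f1 (chord r s t)) / (4 * pi * sqrt s)) (at t within {0..1})"
        by (rule DERIV_cdivide) (use DERIV_mult'[OF 2 1] in simp)
      moreover have "(r * sin (2 * pi * t) * (f2 (chord r s t) * (- 2 * r * sqrt s * (2 * pi) * sin (2 * pi * t)))
          + r * (cos (2 * pi * t) * (2 * pi)) * f1 (chord r s t)) / (4 * pi * sqrt s) = D s t - ?L t"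
      proof -
        define c where "c = cos (2 * pi * t)"
        define S where "S = sin (2 * pi * t)"
        define y where "y = sqrt s"
        have sc: "S\<^sup>2 = 1 - c\<^sup>2" by (simp add: S_def c_def sin_squared_eq)
        have y: "y > 0" "s = y\<^sup>2" using s by (auto simp: y_def)
        have ch: "chord r s t = r\<^sup>2 + y\<^sup>2 + 2 * r * y * c"
          using s by (simp add: chord_def y_def c_def)
        define a b where "a = f1 (chord r s t)" and "b = f2 (chord r s t)"
        have "(r * S * (b * (- 2 * r * y * (2 * pi) * S)) + r * (c * (2 * pi)) * a) / (4 * pi * y)
           = - (r\<^sup>2 * S\<^sup>2 * b) + r * c * a / (2 * y)"
          using y by (simp add: field_simps power2_eq_square)
        also have "\<dots> = b * (1 + r * c / y) * (y\<^sup>2 + r * y * c) + (1 + r * c / (2 * y)) * a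
             - ((r\<^sup>2 + y\<^sup>2 + 2 * r * y * c) * b + a)"
          using y unfolding sc by (simp add: field_simps power2_eq_square)
        finally show ?thesis
          unfolding D_def a_def[symmetric] b_def[symmetric] ch[symmetric]
          unfolding S_def[symmetric] c_def[symmetric] y_def[symmetric] y(2)[symmetric]
          by (simp add: ch a_def b_def)
      qed
      ultimately show "(?h has_vector_derivative D s t - ?L t) (at t within {0..1})"
        by (simp add: has_real_derivative_iff_has_vector_derivative)
    qed simp
    then have 0: "((\<lambda>t. D s t - ?L t) has_integral 0) {0..1}" by simp
    have "?L integrable_on {0..1}"
      using s by (intro integrable_continuous_real continuous_intros continuous_on_chord_compose[OF cf] continuous_on_chord_compose[OF f2]) auto
    then have "(?L has_integral integral {0..1} ?L) {0..1}" by (rule integrable_integral)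
    from has_integral_add[OF 0 this] have "(D s has_integral integral {0..1} ?L) {0..1}" by simp
    then show ?thesis by (simp add: circle_mean_def integral_unique)
  qed
  ultimately show ?thesis
    using s by (simp add: circle_flux_def[abs_def] at_within_open[of s "{0<..}"])
qed

text \<open>Multiplying the bound by \<open>x\<close> gives the next one with a surplus that is a
  nonnegative multiple of \<open>(x - m)\<^sup>2\<close>. Without its square the bound yields
  Jensen's inequality for powers; with it, the gap in \<open>bicircle_mean_gap\<close>.\<close>

lemma power_ge_quadratic:
  fixes x m :: real
  assumes "0 \<le> x" "0 \<le> m"
  shows "m ^ (n + 2) + (real n + 2) * m ^ (n + 1) * (x - m) + m ^ n * (x - m)\<^sup>2 \<le> x ^ (n + 2)"
proof (induction n)
  case 0
  show ?case by (simp add: power2_eq_square algebra_simps)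
next
  case (Suc n)
  have "x * (m ^ (n + 2) + (real n + 2) * m ^ (n + 1) * (x - m) + m ^ n * (x - m)\<^sup>2) \<le> x * x ^ (n + 2)"
    by (rule mult_left_mono[OF Suc assms(1)])
  moreover have "x * (m ^ (n + 2) + (real n + 2) * m ^ (n + 1) * (x - m) + m ^ n * (x - m)\<^sup>2)
     - (m ^ (Suc n + 2) + (real (Suc n) + 2) * m ^ (Suc n + 1) * (x - m) + m ^ Suc n * (x - m)\<^sup>2)
     = (real n + 1) * m ^ (n + 1) * (x - m)\<^sup>2 + x * m ^ n * (x - m)\<^sup>2"
    by (simp add: power2_eq_square algebra_simps)
  moreover have "0 \<le> (real n + 1) * m ^ (n + 1) * (x - m)\<^sup>2 + x * m ^ n * (x - m)\<^sup>2"
    using assms by simp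
  ultimately show ?case by simp
qed

lemma has_integral_cos_2pi: "((\<lambda>t. cos (2 * pi * t)) has_integral 0) {0..1}"
proof -
  have "((\<lambda>t. cos (2 * pi * t)) has_integral (sin (2 * pi * 1) / (2 * pi) - sin (2 * pi * 0) / (2 * pi))) {0..1}"
    by (rule fundamental_theorem_of_calculus)
      (auto intro!: derivative_eq_intros simp flip: has_real_derivative_iff_has_vector_derivative)
  then show ?thesis by simp
qed

lemma has_integral_cos_2pi_squared: "((\<lambda>t. (cos (2 * pi * t))\<^sup>2) has_integral 1 / 2) {0..1}"
proof -
  have "((\<lambda>t. (cos (2 * pi * t))\<^sup>2) has_integral
      ((1 / 2 + sin (4 * pi * 1) / (8 * pi)) - (0 / 2 + sin (4 * pi * 0) / (8 * pi)))) {0..1}"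
  proof (rule fundamental_theorem_of_calculus)
    fix t :: real
    have "((\<lambda>t. t / 2 + sin (4 * pi * t) / (8 * pi)) has_real_derivative 1 / 2 + cos (4 * pi * t) / 2)
        (at t within {0..1})"
      by (auto intro!: derivative_eq_intros)
    moreover have "1 / 2 + cos (4 * pi * t) / 2 = (cos (2 * pi * t))\<^sup>2"
      using cos_double_cos[of "2 * pi * t"] by (simp add: mult.assoc diff_divide_distrib)
    ultimately show "((\<lambda>t. t / 2 + sin (4 * pi * t) / (8 * pi)) has_vector_derivative (cos (2 * pi * t))\<^sup>2)
        (at t within {0..1})"
      by (simp add: has_real_derivative_iff_has_vector_derivative)
  qed simp
  then show ?thesis using sin_npi[of 4] by (simp add: mult.commute)
qed

text \<open>Jensen's inequality, since \<open>chord r s\<close> has mean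
  \<open>r\<^sup>2 + s\<close>, which is at least \<open>s\<close>. The bound is free of
  \<open>r\<close>, so one comparison power of \<open>s\<close> serves all centres.\<close>

lemma circle_mean_power_ge:
  assumes "0 \<le> s"
  shows "s ^ (n + 2) \<le> circle_mean (\<lambda>u. u ^ (n + 2)) r s"
proof -
  let ?A = "r\<^sup>2 + s" and ?c = "\<lambda>t. cos (2 * pi * t)"
  let ?K = "(real n + 2) * ?A ^ (n + 1) * (2 * r * sqrt s)"
  have "((\<lambda>t. ?A ^ (n + 2) + ?K * ?c t) has_integral (?A ^ (n + 2) + ?K * 0)) {0..1}"
    using has_integral_add[OF has_integral_const_real[of "?A ^ (n + 2)" 0 1]
      has_integral_mult_right[OF has_integral_cos_2pi, of ?K]] by simp
  moreover have "((\<lambda>t. chord r s t ^ (n + 2)) has_integral circle_mean (\<lambda>u. u ^ (n + 2)) r s) {0..1}"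
    unfolding circle_mean_def
    by (intro integrable_integral integrable_continuous_real continuous_intros)
  ultimately have "?A ^ (n + 2) + ?K * 0 \<le> circle_mean (\<lambda>u. u ^ (n + 2)) r s"
  proof (rule has_integral_le)
    fix t :: real
    have "?A ^ (n + 2) + ?K * ?c t \<le> ?A ^ (n + 2) + (real n + 2) * ?A ^ (n + 1) * (chord r s t - ?A)
       + ?A ^ n * (chord r s t - ?A)\<^sup>2"
      using assms by (simp add: chord_def algebra_simps)
    also have "\<dots> \<le> chord r s t ^ (n + 2)"
      by (rule power_ge_quadratic) (use assms in \<open>auto intro: chord_nonneg\<close>)
    finally show "?A ^ (n + 2) + ?K * ?c t \<le> chord r s t ^ (n + 2)" .
  qed
  moreover have "s ^ (n + 2) \<le> ?A ^ (n + 2)"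
    by (rule power_mono) (use assms in auto)
  ultimately show ?thesis by simp
qed

section \<open>Shifted powers and the strict convexity of their circular means\<close>

lemma DERIV_shifted_powr:
  fixes u e a :: real
  assumes "0 \<le> u" "0 < e"
  shows "((\<lambda>u. (u + e) powr a) has_real_derivative a * (u + e) powr (a - 1)) (at u within A)"
proof -
  have "((\<lambda>u. (u + e) powr a) has_real_derivative a * (u + e) powr (a - 1) * 1) (at u within A)"
    by (rule DERIV_chain2[where f="\<lambda>z. z powr a"])
       (use assms in \<open>auto intro!: has_real_derivative_powr derivative_eq_intros\<close>)
  then show ?thesis by simp
qed

text \<open>The right-hand side is one sixteenth of the bilaplacian of \<open>(|x|\<^sup>2 + e)\<^sup>q\<close> at \<open>|x|\<^sup>2 = u\<close>. The shift
  by \<open>e\<close> is needed because \<open>|x|\<^sup>2\<^sup>q\<close> is in general not four times differentiable at the origin.\<close>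

lemma shifted_powr_bilaplacian_ge:
  fixes q u e :: real
  assumes q: "1 < q" and u: "0 \<le> u" and e: "0 < e"
  defines "w \<equiv> u + e"
  shows "q * (q - 1) * (2 * (q - 1)\<^sup>2 / ((q - 1)\<^sup>2 + 2)) * w powr (q - 2) \<le>
    u\<^sup>2 * (q * (q - 1) * (q - 2) * (q - 3) * w powr (q - 4)) + 4 * u * (q * (q - 1) * (q - 2) * w powr (q - 3))
     + 2 * (q * (q - 1) * w powr (q - 2))"
proof -
  have w: "0 < w" "u \<le> w" using u e by (auto simp: w_def)
  define W where "W = w powr (q - 4)"
  have W: "0 < W" using w by (simp add: W_def)
  have 3: "w powr (q - 3) = w * W"
    using w powr_add[of w 1 "q - 4"] by (simp add: W_def)
  have 2: "w powr (q - 2) = w\<^sup>2 * W"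
    using w powr_add[of w 2 "q - 4"] by (simp add: W_def)
  define g where "g = q - 1"
  have g: "0 < g" "q = g + 1" using q by (auto simp: g_def)
  \<comment> \<open>Divided by \<open>q * g * W\<close>, the bilaplacian expression is this
    right-hand side plus \<open>g * u * (4 * w - 3 * u)\<close>, which is nonnegative because
    \<open>u <= w\<close>. The constant is the minimum over \<open>u\<close>, attained at
    \<open>u = 2 * w / (g\<^sup>2 + 2)\<close>.\<close>
  have "2 * g\<^sup>2 / (g\<^sup>2 + 2) * w\<^sup>2 \<le> g\<^sup>2 * u\<^sup>2 + 2 * (w - u)\<^sup>2"
  proof -
    have pos: "0 < g\<^sup>2 + 2" by (rule add_nonneg_pos) auto
    have "(g\<^sup>2 * u\<^sup>2 + 2 * (w - u)\<^sup>2) * (g\<^sup>2 + 2) - 2 * g\<^sup>2 * w\<^sup>2 = ((g\<^sup>2 + 2) * u - 2 * w)\<^sup>2"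
      by (simp add: power2_eq_square algebra_simps)
    then have "2 * g\<^sup>2 * w\<^sup>2 \<le> (g\<^sup>2 * u\<^sup>2 + 2 * (w - u)\<^sup>2) * (g\<^sup>2 + 2)"
      by (metis diff_ge_0_iff_ge zero_le_power2)
    then show ?thesis using pos by (simp add: pos_divide_le_eq)
  qed
  moreover have "0 \<le> g * u * (4 * w - 3 * u)" using g w u by simp
  ultimately have "2 * g\<^sup>2 / (g\<^sup>2 + 2) * w\<^sup>2 \<le> g\<^sup>2 * u\<^sup>2 + 2 * (w - u)\<^sup>2 + g * u * (4 * w - 3 * u)"
    by linarith
  from mult_left_mono[OF this, of "q * g * W"]
  have "q * g * W * (2 * g\<^sup>2 / (g\<^sup>2 + 2) * w\<^sup>2) \<le> q * g * W * (g\<^sup>2 * u\<^sup>2 + 2 * (w - u)\<^sup>2 + g * u * (4 * w - 3 * u))"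
    using q g W by simp
  also have "\<dots> = u\<^sup>2 * (q * (q - 1) * (q - 2) * (q - 3) * W) + 4 * u * (q * (q - 1) * (q - 2) * (w * W))
     + 2 * (q * (q - 1) * (w\<^sup>2 * W))"
    unfolding g(2) by (simp add: power2_eq_square algebra_simps)
  finally show ?thesis
    unfolding 2 3 W_def[symmetric] g_def by (simp add: mult_ac)
qed

text \<open>The term \<open>C s\<^sup>n\<^sup>+\<^sup>2\<close>, with \<open>C\<close> independent of \<open>e\<close>, keeps the convexity strict in the limit \<open>e \<rightarrow> 0\<close>.\<close>

lemma convex_on_circle_mean_shifted_powr:
  fixes q R S :: real
  assumes q: "1 < q" and R: "0 \<le> R" and S: "0 < S"
  obtains C n where "0 < C"
    "\<And>e r. 0 < e \<Longrightarrow> e \<le> 1 \<Longrightarrow> 0 \<le> r \<Longrightarrow> r \<le> R \<Longrightarrow>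
      convex_on {0<..<S} (\<lambda>s. circle_mean (\<lambda>u. (u + e) powr q) r s - C * s ^ (n + 2))"
proof -
  \<comment> \<open>Since \<open>i >= q\<close>, the exponent \<open>q - 2 - n\<close> is negative,
    so a power of \<open>U + 1\<close> bounds that power of \<open>u + e\<close> from below for all
    shifts \<open>e <= 1\<close>. The extra 2 in \<open>n\<close> matches the exponent
    \<open>n + 2\<close> in \<open>circle_mean_power_ge\<close>.\<close>
  define i where "i = nat \<lceil>q\<rceil>"
  define n where "n = i + 2"
  have iq: "q \<le> real i" using q by (simp add: i_def)
  \<comment> \<open>An upper bound for all values of \<open>chord r s\<close> with
    \<open>r <= R\<close> and \<open>s < S\<close>.\<close>
  define U where "U = (R + sqrt S)\<^sup>2"
  have U: "0 \<le> U" by (simp add: U_def)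
  define c where "c = q * (q - 1) * (2 * (q - 1)\<^sup>2 / ((q - 1)\<^sup>2 + 2)) * (U + 1) powr (q - 2 - real n)"
  have c: "0 < c"
    unfolding c_def using q U by (intro mult_pos_pos divide_pos_pos) (auto intro: add_nonneg_pos)
  \<comment> \<open>Applying \<open>d/ds (s d/ds)\<close> twice turns \<open>C * s ^ (n + 2)\<close>
    into exactly \<open>c * s ^ n\<close>, the lower bound for \<open>l\<close>.\<close>
  define C where "C = c / ((real n + 2)\<^sup>2 * (real n + 1)\<^sup>2)"
  have C: "0 < C" unfolding C_def using c by (intro divide_pos_pos mult_pos_pos) auto
  have C_eq: "C * (real n + 2)\<^sup>2 * (real n + 1)\<^sup>2 = c"
    by (simp add: C_def)
  show ?thesis
  proof (rule that[OF C, where n = n])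
    fix e r :: real assume e: "0 < e" "e \<le> 1" and r: "0 \<le> r" "r \<le> R"
    define F where "F = (\<lambda>a u. (u + e) powr a)"
    define f2 where "f2 = (\<lambda>u. q * (q - 1) * F (q - 2) u)"
    define f3 where "f3 = (\<lambda>u. q * (q - 1) * (q - 2) * F (q - 3) u)"
    define f4 where "f4 = (\<lambda>u. q * (q - 1) * (q - 2) * (q - 3) * F (q - 4) u)"
    define f1 where "f1 = (\<lambda>u. q * F (q - 1) u)"
    \<comment> \<open>As radial functions, \<open>h\<close> is a quarter of the Laplacian of
      \<open>F q\<close>, and \<open>l\<close> below is a sixteenth of its bilaplacian.\<close>
    define h where "h = (\<lambda>u. u * f2 u + f1 u)"
    define h1 where "h1 = (\<lambda>u. u * f3 u + 2 * f2 u)"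
    define h2 where "h2 = (\<lambda>u. u * f4 u + 3 * f3 u)"
    define l where "l = (\<lambda>u. u * h2 u + h1 u)"
    have F: "(F a has_real_derivative a * F (a - 1) u) (at u)" if "0 \<le> u" for a u
      unfolding F_def by (rule DERIV_shifted_powr[OF that e(1)])
    have cF: "continuous_on {0..} (F a)" for a
      by (rule DERIV_continuous_on[where D="\<lambda>u. a * F (a - 1) u"])
        (use F in \<open>auto intro: has_field_derivative_at_within\<close>)
    have 1: "(F q has_real_derivative f1 u) (at u)" if "0 \<le> u" for u
      unfolding f1_def by (rule F[OF that])
    have 2: "(f1 has_real_derivative f2 u) (at u)" if "0 \<le> u" for u
      unfolding f1_def f2_def
      by (rule DERIV_cong[OF DERIV_cmult[OF F[OF that]]]) (simp add: algebra_simps)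
    have 3: "(f2 has_real_derivative f3 u) (at u)" if "0 \<le> u" for u
      unfolding f3_def f2_def
      by (rule DERIV_cong[OF DERIV_cmult[OF F[OF that]]]) (simp add: algebra_simps)
    have 4: "(f3 has_real_derivative f4 u) (at u)" if "0 \<le> u" for u
      unfolding f3_def f4_def
      by (rule DERIV_cong[OF DERIV_cmult[OF F[OF that]]]) (simp add: algebra_simps)
    have 5: "(h has_real_derivative h1 u) (at u)" if "0 \<le> u" for u
      unfolding h_def h1_def
      by (rule DERIV_cong[OF DERIV_add[OF DERIV_mult[OF DERIV_ident 3[OF that]] 2[OF that]]])
        (simp add: algebra_simps)
    have 6: "(h1 has_real_derivative h2 u) (at u)" if "0 \<le> u" for u
      unfolding h1_def h2_def
      by (rule DERIV_cong[OF DERIV_add[OF DERIV_mult[OF DERIV_ident 4[OF that]] DERIV_cmult[OF 3[OF that], of 2]]])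
        (simp add: algebra_simps)
    have cont: "continuous_on {0..} f1" "continuous_on {0..} f2" "continuous_on {0..} h1"
       "continuous_on {0..} h2" "continuous_on {0..} l"
      unfolding l_def h1_def h2_def f1_def f2_def f3_def f4_def by (intro continuous_intros cF)+
    have l_ge: "c * u ^ n \<le> l u" if u: "0 \<le> u" "u \<le> U" for u
    proof -
      let ?w = "u + e"
      have w: "0 < ?w" "?w \<le> U + 1" "u \<le> ?w" using u e by auto
      have "(U + 1) powr (q - 2 - real n) * u ^ n \<le> ?w powr (q - 2 - real n) * ?w ^ n"
        using w u U iq by (intro mult_mono powr_mono2' power_mono) (auto simp: n_def)
      also have "\<dots> = ?w powr (q - 2)"
        using w by (simp add: powr_realpow[symmetric] powr_add[symmetric])
      finally have "q * (q - 1) * (2 * (q - 1)\<^sup>2 / ((q - 1)\<^sup>2 + 2)) * ((U + 1) powr (q - 2 - real n) * u ^ n)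
         \<le> q * (q - 1) * (2 * (q - 1)\<^sup>2 / ((q - 1)\<^sup>2 + 2)) * ?w powr (q - 2)"
        using q by (intro mult_left_mono) auto
      also note shifted_powr_bilaplacian_ge[OF q u(1) e(1)]
      finally show ?thesis
        unfolding c_def l_def h1_def h2_def f2_def f3_def f4_def F_def
        by (simp add: power2_eq_square algebra_simps)
    qed
    let ?M = "\<lambda>s. circle_mean (F q) r s - C * s ^ (n + 2)"
    let ?P = "\<lambda>s. circle_flux f1 r s - C * (real n + 2) * s ^ (n + 2)"
    let ?N = "\<lambda>s. circle_mean h r s - C * (real n + 2)\<^sup>2 * s ^ (n + 1)"
    let ?Q = "\<lambda>s. circle_flux h1 r s - C * (real n + 2)\<^sup>2 * (real n + 1) * s ^ (n + 1)"
    let ?l = "\<lambda>s. circle_mean l r s - C * (real n + 2)\<^sup>2 * (real n + 1)\<^sup>2 * s ^ n"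
    have "convex_on {0<..<S} ?M"
    proof (rule convex_on_of_iterated_euler_derivatives[where M="?M" and P="?P" and N="?N" and Q="?Q" and l="?l"])
      fix s assume s: "0 < s" "s < S"
      have pow1: "((\<lambda>s. K * s ^ (n + 1)) has_real_derivative K * ((real n + 1) * s ^ n)) (at s)" for K
        by (rule DERIV_cong[OF DERIV_cmult[OF DERIV_pow]]) simp
      have pow2: "((\<lambda>s. K * s ^ (n + 2)) has_real_derivative K * ((real n + 2) * s ^ (n + 1))) (at s)" for K
        by (rule DERIV_cong[OF DERIV_cmult[OF DERIV_pow]]) simp
      show "(?M has_real_derivative ?P s / s) (at s)"
        by (rule DERIV_cong[OF DERIV_diff[OF DERIV_circle_mean[OF 1 cont(1) s(1)] pow2[of C]]])
          (use s in \<open>auto simp: field_simps\<close>)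
      show "(?P has_real_derivative ?N s) (at s)"
        by (rule DERIV_cong[OF DERIV_diff[OF DERIV_circle_flux[OF 2 cont(2) s(1)] pow2[of "C * (real n + 2)"]]])
          (use s in \<open>auto simp: h_def power2_eq_square algebra_simps\<close>)
      show "(?N has_real_derivative ?Q s / s) (at s)"
        by (rule DERIV_cong[OF DERIV_diff[OF DERIV_circle_mean[OF 5 cont(3) s(1)] pow1[of "C * (real n + 2)\<^sup>2"]]])
          (use s in \<open>auto simp: field_simps\<close>)
      show "(?Q has_real_derivative ?l s) (at s)"
        by (rule DERIV_cong[OF DERIV_diff[OF DERIV_circle_flux[OF 6 cont(4) s(1)] pow1[of "C * (real n + 2)\<^sup>2 * (real n + 1)"]]])
          (use s in \<open>auto simp: l_def power2_eq_square algebra_simps\<close>)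
      show "0 \<le> ?l s"
      proof -
        have "c * s ^ n \<le> c * circle_mean (\<lambda>u. u ^ n) r s"
          using circle_mean_power_ge[of s i r] c s by (intro mult_left_mono) (auto simp: n_def)
        also have "\<dots> = integral {0..1} (\<lambda>t. c * chord r s t ^ n)"
          by (simp add: circle_mean_def)
        also have "\<dots> \<le> integral {0..1} (\<lambda>t. l (chord r s t))"
        proof (rule integral_le)
          show "(\<lambda>t. c * chord r s t ^ n) integrable_on {0..1}"
            by (intro integrable_continuous_real continuous_intros)
          show "(\<lambda>t. l (chord r s t)) integrable_on {0..1}"
            by (intro integrable_continuous_real continuous_on_chord_compose[OF cont(5)] continuous_intros)
              (use s in auto)
          fix t :: real
          have "chord r s t \<le> (r + sqrt s)\<^sup>2" using r s by (intro chord_le) auto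
          also have "\<dots> \<le> U" unfolding U_def using r s by (intro power_mono add_mono) auto
          finally show "c * chord r s t ^ n \<le> l (chord r s t)"
            using s by (intro l_ge chord_nonneg) auto
        qed
        finally show ?thesis unfolding C_eq by (simp add: circle_mean_def)
      qed
    next
      show "continuous_on {0..<S} ?P" "continuous_on {0..<S} ?Q"
        by (intro continuous_intros continuous_on_subset[OF continuous_on_circle_flux] cont, auto)+
    qed auto
    then show "convex_on {0<..<S} (\<lambda>s. circle_mean (\<lambda>u. (u + e) powr q) r s - C * s ^ (n + 2))"
      by (simp add: F_def)
  qed
qed

section \<open>The two-dimensional mean\<close>

text \<open>For \<open>m = |x|\<^sup>2 + |y|\<^sup>2\<close>, \<open>k = |x||y|\<close> and \<open>r = |w|\<close> this is the mean of \<open>f(|x z\<^sub>1 + y z\<^sub>2 + w|\<^sup>2)\<close> over the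
  two-dimensional torus.\<close>

definition bicircle_mean :: "(real \<Rightarrow> real) \<Rightarrow> real \<Rightarrow> real \<Rightarrow> real \<Rightarrow> real" where
  "bicircle_mean f m k r = integral {0..1} (\<lambda>t. circle_mean f r (m + 2 * k * cos (2 * pi * t)))"

lemma bicircle_radius_bounds:
  fixes m k :: real
  assumes "0 \<le> k" "2 * k \<le> m"
  shows "m - 2 * k \<le> m + 2 * k * cos x" "m + 2 * k * cos x \<le> m + 2 * k" "0 \<le> m + 2 * k * cos x"
proof -
  have "2 * k * - 1 \<le> 2 * k * cos x" "2 * k * cos x \<le> 2 * k * 1"
    using assms(1) by (intro mult_left_mono; simp)+
  then show "m - 2 * k \<le> m + 2 * k * cos x" "m + 2 * k * cos x \<le> m + 2 * k"
    "0 \<le> m + 2 * k * cos x" using assms by linarith+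
qed

lemma has_integral_bicircle_mean:
  assumes "continuous_on {0..} f" "0 \<le> k" "2 * k \<le> m"
  shows "((\<lambda>t. circle_mean f r (m + 2 * k * cos (2 * pi * t))) has_integral bicircle_mean f m k r) {0..1}"
  unfolding bicircle_mean_def
  by (intro integrable_integral integrable_continuous_real
       continuous_on_compose2[OF continuous_on_circle_mean[OF assms(1)]] continuous_intros)
     (use bicircle_radius_bounds[OF assms(2,3)] in auto)

lemma has_integral_circle_mean:
  assumes "continuous_on {0..} f" "0 \<le> s"
  shows "((\<lambda>t. f (chord r s t)) has_integral circle_mean f r s) {0..1}"
  unfolding circle_mean_def
  by (intro integrable_integral integrable_continuous_real continuous_on_chord_compose[OF assms(1)]
       continuous_intros) (use assms in auto)

lemma circle_mean_mono:
  assumes "continuous_on {0..} f" "continuous_on {0..} g" "0 \<le> r" "0 \<le> s"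
    and "\<And>u. 0 \<le> u \<Longrightarrow> u \<le> (r + sqrt s)\<^sup>2 \<Longrightarrow> f u \<le> g u"
  shows "circle_mean f r s \<le> circle_mean g r s"
  by (rule has_integral_le[OF has_integral_circle_mean has_integral_circle_mean])
    (use assms chord_nonneg chord_le in auto)

lemma bicircle_mean_mono:
  assumes "continuous_on {0..} f" "continuous_on {0..} g" "0 \<le> r" "0 \<le> k" "2 * k \<le> m"
    and "\<And>u. 0 \<le> u \<Longrightarrow> u \<le> (r + sqrt (m + 2 * k))\<^sup>2 \<Longrightarrow> f u \<le> g u"
  shows "bicircle_mean f m k r \<le> bicircle_mean g m k r"
proof (rule has_integral_le[OF has_integral_bicircle_mean has_integral_bicircle_mean])
  fix t :: real
  let ?s = "m + 2 * k * cos (2 * pi * t)"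
  have "0 \<le> ?s" "?s \<le> m + 2 * k" using bicircle_radius_bounds[OF assms(4,5)] by auto
  moreover from this have "(r + sqrt ?s)\<^sup>2 \<le> (r + sqrt (m + 2 * k))\<^sup>2"
    using assms(3) by (intro power_mono add_left_mono) auto
  ultimately show "circle_mean f r ?s \<le> circle_mean g r ?s"
    by (intro circle_mean_mono assms) auto
qed (use assms in auto)

lemma circle_mean_const [simp]: "circle_mean (\<lambda>_. c) r s = c"
  by (simp add: circle_mean_def)

lemma bicircle_mean_const [simp]: "bicircle_mean (\<lambda>_. c) m k r = c"
  by (simp add: bicircle_mean_def)

lemma bicircle_mean_add_const:
  assumes "continuous_on {0..} f" "0 \<le> k" "2 * k \<le> m"
  shows "bicircle_mean (\<lambda>u. f u + c) m k r = bicircle_mean f m k r + c"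
proof -
  have cm: "circle_mean (\<lambda>u. f u + c) r s = circle_mean f r s + c" if "0 \<le> s" for s
    using has_integral_add[OF has_integral_circle_mean[OF assms(1) that, of r] has_integral_const_real[of c 0 1]]
    by (simp add: circle_mean_def integral_unique)
  have "bicircle_mean (\<lambda>u. f u + c) m k r
      = integral {0..1} (\<lambda>t. circle_mean f r (m + 2 * k * cos (2 * pi * t)) + c)"
    unfolding bicircle_mean_def using bicircle_radius_bounds(3)[OF assms(2,3)] by (simp add: cm)
  also have "\<dots> = bicircle_mean f m k r + c"
    using has_integral_add[OF has_integral_bicircle_mean[OF assms] has_integral_const_real[of c 0 1]]
    by (simp add: integral_unique)
  finally show ?thesis .
qed

lemma continuous_on_shifted_powr:
  fixes q e :: real
  assumes "0 < q" "0 \<le> e"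
  shows "continuous_on {0..} (\<lambda>u. (u + e) powr q)"
  by (rule continuous_on_powr') (use assms in \<open>auto intro!: continuous_intros\<close>)

lemma shifted_powr_le:
  fixes q U d :: real
  assumes q: "0 < q" and d: "0 < d"
  obtains e where "0 < e" "e \<le> 1" "\<And>u. 0 \<le> u \<Longrightarrow> u \<le> U \<Longrightarrow> (u + e) powr q \<le> u powr q + d"
proof -
  have "continuous_on {0..U + 1} (\<lambda>u. u powr q)"
    by (rule continuous_on_subset[OF continuous_on_shifted_powr[OF q, of 0, simplified]]) auto
  then have "uniformly_continuous_on {0..U + 1} (\<lambda>u. u powr q)"
    by (rule compact_uniformly_continuous) simp
  then obtain e0 where e0: "0 < e0"
    "\<And>x y. x \<in> {0..U+1} \<Longrightarrow> y \<in> {0..U+1} \<Longrightarrow> dist y x < e0 \<Longrightarrow> dist (y powr q) (x powr q) < d"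
    unfolding uniformly_continuous_on_def using d by blast
  show thesis
  proof (rule that[of "min (e0 / 2) 1"])
    fix u assume u: "0 \<le> u" "u \<le> U"
    have "dist ((u + min (e0 / 2) 1) powr q) (u powr q) < d"
      using u e0(1) by (intro e0(2)) (auto simp: dist_real_def)
    then show "(u + min (e0 / 2) 1) powr q \<le> u powr q + d" by (simp add: dist_real_def)
  qed (use e0 in auto)
qed

text \<open>At \<open>k = 0\<close> the mean is \<open>circle_mean f r m\<close>. Averaging a
  tangent bound with quadratic remainder puts the mean at \<open>k\<close> above that value by
  \<open>2 * C * m ^ n * k\<^sup>2\<close>; convexity then interpolates between \<open>0\<close> and
  \<open>k\<close>. The condition \<open>2 * k < m\<close> keeps all squared radii inside the open
  interval of convexity.\<close>

lemma bicircle_mean_gap: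
  assumes conv: "convex_on {0<..<S} (\<lambda>s. circle_mean f r s - C * s ^ (n + 2))"
    and f: "\<And>u. 0 \<le> u \<Longrightarrow> (f has_real_derivative f1 u) (at u)" and f1: "continuous_on {0..} f1"
    and C: "0 \<le> C" and k: "0 < k" "2 * k < m" "m + 2 * k < S" and k': "0 \<le> k'" "k' \<le> k"
  shows "bicircle_mean f m k' r \<le> bicircle_mean f m k r - (1 - k' / k) * (2 * C * m ^ n * k\<^sup>2)"
proof -
  have cf: "continuous_on {0..} f"
    by (rule DERIV_continuous_on[where D=f1]) (use f in \<open>auto intro: has_field_derivative_at_within\<close>)
  define M where "M = circle_mean f r"
  define F where "F = (\<lambda>s. M s - C * s ^ (n + 2))"
  have F: "convex_on {0<..<S} F" using conv by (simp add: F_def M_def)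
  have m: "m \<in> {0<..<S}" using k by auto
  have in_S: "m + 2 * k * cos x \<in> {0<..<S}" for x
  proof -
    have "m - 2 * k \<le> m + 2 * k * cos x" "m + 2 * k * cos x \<le> m + 2 * k"
      by (rule bicircle_radius_bounds; use k in simp)+
    then show ?thesis using k unfolding greaterThanLessThan_iff by linarith
  qed
  define F' where "F' = circle_flux f1 r m / m - C * ((real n + 2) * m ^ (n + 1))"
  have "(F has_real_derivative F') (at m)"
    unfolding F_def F'_def M_def using m
    by (auto intro!: DERIV_diff DERIV_circle_mean[OF f f1] DERIV_cmult simp del: power_Suc
       intro: DERIV_cong[OF DERIV_pow])
  then have F'_in: "(F has_real_derivative F') (at m within {0<..<S})"
    by (rule has_field_derivative_at_within)
  \<comment> \<open>The slope of \<open>M\<close> at \<open>m\<close>. Its value is immaterial,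
    because the term it multiplies in \<open>tangent\<close> has mean zero.\<close>
  define B where "B = F' + C * ((real n + 2) * m ^ (n + 1))"
  have tangent: "M m + B * (2 * k * cos x) + 4 * C * m ^ n * k\<^sup>2 * (cos x)\<^sup>2
      \<le> M (m + 2 * k * cos x)" for x
  proof -
    let ?y = "m + 2 * k * cos x"
    have "F' * (?y - m) \<le> F ?y - F m"
      using convex_on_imp_above_tangent[OF F _ _ in_S F'_in] m by auto
    moreover have "C * (m ^ (n + 2) + (real n + 2) * m ^ (n + 1) * (?y - m) + m ^ n * (?y - m)\<^sup>2) \<le> C * ?y ^ (n + 2)"
      using power_ge_quadratic[of ?y m n] in_S[of x] m C by (intro mult_left_mono) auto
    ultimately show ?thesis
      by (simp add: F_def B_def power2_eq_square algebra_simps)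
  qed
  have gap: "M m + 2 * C * m ^ n * k\<^sup>2 \<le> bicircle_mean f m k r"
  proof (rule has_integral_le)
    show "((\<lambda>t. M m + B * (2 * k * cos (2 * pi * t))
        + 4 * C * m ^ n * k\<^sup>2 * (cos (2 * pi * t))\<^sup>2) has_integral (M m + 2 * C * m ^ n * k\<^sup>2)) {0..1}"
      using has_integral_add[OF has_integral_add[OF has_integral_const_real[of "M m" 0 1]
        has_integral_mult_right[OF has_integral_cos_2pi, of "B * (2 * k)"]]
        has_integral_mult_right[OF has_integral_cos_2pi_squared, of "4 * C * m ^ n * k\<^sup>2"]]
      by (simp add: mult_ac)
    show "((\<lambda>t. M (m + 2 * k * cos (2 * pi * t))) has_integral bicircle_mean f m k r) {0..1}"
      unfolding M_def by (rule has_integral_bicircle_mean[OF cf]) (use k in auto)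
  qed (rule tangent)
  \<comment> \<open>The squared radius for \<open>k'\<close> is the convex combination, with weights
    \<open>1 - v\<close> and \<open>v\<close>, of \<open>m\<close> and the squared radius for
    \<open>k\<close> at the same angle.\<close>
  define v where "v = k' / k"
  have v: "0 \<le> v" "v \<le> 1" "k' = v * k" using k k' by (auto simp: v_def)
  have M_conv: "convex_on {0<..<S} M"
  proof -
    have "convex_on {0..} (\<lambda>s::real. s ^ (n + 2))"
    proof (cases "even n")
      case True
      then have "even (n + 2)" by simp
      from convex_power_even[OF this] show ?thesis by (rule convex_on_subset) auto
    next
      case False
      then have "odd (n + 2)" by simp
      then show ?thesis by (rule convex_power_odd)
    qed
    then have "convex_on {0<..<S} (\<lambda>s. s ^ (n + 2))"
      by (rule convex_on_subset) auto
    then have "convex_on {0<..<S} (\<lambda>s. C * s ^ (n + 2))"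
      by (rule convex_on_cmul[OF C])
    from convex_on_add[OF F this] show ?thesis by (simp add: F_def)
  qed
  have "bicircle_mean f m k' r \<le> (1 - v) * M m + v * bicircle_mean f m k r"
  proof (rule has_integral_le)
    show "((\<lambda>t. M (m + 2 * k' * cos (2 * pi * t))) has_integral bicircle_mean f m k' r) {0..1}"
      unfolding M_def by (rule has_integral_bicircle_mean[OF cf]) (use k k' in auto)
    show "((\<lambda>t. (1 - v) * M m + v * M (m + 2 * k * cos (2 * pi * t))) has_integral
        ((1 - v) * M m + v * bicircle_mean f m k r)) {0..1}"
      using has_integral_add[OF has_integral_const_real[of "(1 - v) * M m" 0 1]
        has_integral_mult_right[OF has_integral_bicircle_mean[OF cf, of k m r], of v]] k
      by (simp add: M_def)
    fix t :: real
    have "M ((1 - v) *\<^sub>R m + v *\<^sub>R (m + 2 * k * cos (2 * pi * t))) \<le> (1 - v) * M m + v * M (m + 2 * k * cos (2 * pi * t))"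
      by (rule convex_onD[OF M_conv v(1,2) m in_S])
    then show "M (m + 2 * k' * cos (2 * pi * t)) \<le> (1 - v) * M m + v * M (m + 2 * k * cos (2 * pi * t))"
      by (simp add: v(3) algebra_simps)
  qed
  also have "\<dots> \<le> (1 - v) * (bicircle_mean f m k r - 2 * C * m ^ n * k\<^sup>2) + v * bicircle_mean f m k r"
    using gap v by (intro add_right_mono mult_left_mono) auto
  finally show ?thesis unfolding v_def by (simp add: algebra_simps)
qed

text \<open>The shift is removed by squeezing: \<open>u powr q\<close> lies below the shifted power,
  which exceeds it by at most \<open>d\<close> on the bounded range involved. The gap depends
  neither on the shift nor on the centre \<open>r\<close> in \<open>[0, R]\<close>, so it can later
  be integrated over the centre.\<close>

lemma bicircle_mean_powr_gap:
  fixes q R k m :: real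
  assumes q: "1 < q" and R: "0 \<le> R" and k: "0 < k" "2 * k < m"
  obtains D where "0 < D"
    "\<And>r k'. 0 \<le> r \<Longrightarrow> r \<le> R \<Longrightarrow> 0 \<le> k' \<Longrightarrow> k' \<le> k \<Longrightarrow>
      bicircle_mean (\<lambda>u. u powr q) m k' r \<le> bicircle_mean (\<lambda>u. u powr q) m k r - (1 - k' / k) * D"
proof -
  define S where "S = m + 2 * k + 1"
  have S: "0 < S" "m + 2 * k < S" using k by (auto simp: S_def)
  obtain C n where C: "0 < C" and conv: "\<And>e r. 0 < e \<Longrightarrow> e \<le> 1 \<Longrightarrow> 0 \<le> r \<Longrightarrow> r \<le> R \<Longrightarrow>
      convex_on {0<..<S} (\<lambda>s. circle_mean (\<lambda>u. (u + e) powr q) r s - C * s ^ (n + 2))"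
    using convex_on_circle_mean_shifted_powr[OF q R S(1)] by blast
  let ?f = "\<lambda>e u. (u + e) powr q"
  have cont: "continuous_on {0..} (?f e)" if "0 \<le> e" for e
    using q that by (intro continuous_on_shifted_powr) auto
  have cont0: "continuous_on {0..} (\<lambda>u. u powr q)" using cont[of 0] by simp
  show thesis
  proof (rule that)
    show "0 < 2 * C * m ^ n * k\<^sup>2" using C k by simp
    fix r k' assume r: "0 \<le> r" "r \<le> R" and k': "0 \<le> k'" "k' \<le> k"
    show "bicircle_mean (\<lambda>u. u powr q) m k' r \<le> bicircle_mean (\<lambda>u. u powr q) m k r
      - (1 - k' / k) * (2 * C * m ^ n * k\<^sup>2)" (is "?L \<le> ?R")
    proof (rule field_le_epsilon)
      fix d :: real assume d: "0 < d"
      obtain e where e: "0 < e" "e \<le> 1"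
        and le: "\<And>u. 0 \<le> u \<Longrightarrow> u \<le> (r + sqrt (m + 2 * k))\<^sup>2 \<Longrightarrow> ?f e u \<le> u powr q + d"
        using shifted_powr_le[of q d "(r + sqrt (m + 2 * k))\<^sup>2"] q d by auto
      have "?L \<le> bicircle_mean (?f e) m k' r"
        by (rule bicircle_mean_mono)
          (use k k' r e q cont[of 0] cont[of e] in \<open>auto intro!: powr_mono2\<close>)
      also have "\<dots> \<le> bicircle_mean (?f e) m k r - (1 - k' / k) * (2 * C * m ^ n * k\<^sup>2)"
      proof (rule bicircle_mean_gap[OF conv[OF e r]])
        show "continuous_on {0..} (\<lambda>u. q * (u + e) powr (q - 1))"
          using q e by (intro continuous_on_mult continuous_on_const continuous_on_shifted_powr) auto
        show "\<And>u. 0 \<le> u \<Longrightarrow> (?f e has_real_derivative q * (u + e) powr (q - 1)) (at u)"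
          by (rule DERIV_shifted_powr) (use e in auto)
      qed (use C k k' S in auto)
      also have "bicircle_mean (?f e) m k r \<le> bicircle_mean (\<lambda>u. u powr q + d) m k r"
        by (rule bicircle_mean_mono) (use k k' r e q cont[of e] le in \<open>auto intro!: continuous_intros cont0\<close>)
      also have "\<dots> = bicircle_mean (\<lambda>u. u powr q) m k r + d"
        by (rule bicircle_mean_add_const[OF cont0]) (use k in auto)
      finally show "?L \<le> ?R + d" by simp
    qed
  qed
qed

section \<open>Integration over the torus\<close>

lemma integral_shift_periodic:
  fixes g :: "real \<Rightarrow> 'b::euclidean_space"
  assumes g: "continuous_on UNIV g" and per: "\<And>t. g (t + 1) = g t" and a: "0 \<le> a" "a \<le> 1"
  shows "integral {0..1} (\<lambda>t. g (t + a)) = integral {0..1} g"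
proof -
  have int: "g integrable_on {x..y}" for x y
    by (intro integrable_continuous_real continuous_on_subset[OF g]) auto
  have "integral {0..1} (\<lambda>t. g (t + a)) = integral {a..1 + a} g"
    using integral_shift_Icc_real[of 0 1 g a] by (simp add: o_def add.commute)
  also have "\<dots> = integral {a..1} g + integral {1..1 + a} g"
    by (rule Henstock_Kurzweil_Integration.integral_combine[symmetric, OF _ _ int]) (use a in auto)
  also have "integral {1..1 + a} g = integral {0..a} g"
    using integral_shift_Icc_real[of 0 a g 1] by (simp add: o_def add.commute per)
  also have "integral {a..1} g + integral {0..a} g = integral {0..1} g"
    using Henstock_Kurzweil_Integration.integral_combine[OF a int] by (simp add: add.commute)
  finally show ?thesis .
qed

section \<open>Rotation invariance and means over one and two circles\<close>

lemma space_circle_measure [simp]: "space circle_measure = sphere 0 1"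
  by (simp add: circle_measure_def space_restrict_space)

lemma sets_circle_measure [measurable_cong]: "sets circle_measure = sets (restrict_space borel (sphere 0 1))"
  by (simp add: circle_measure_def)

interpretation circle: prob_space circle_measure
  by (rule prob_space_circle_measure)

interpretation circle_pair: pair_prob_space circle_measure circle_measure ..

interpretation circle_prod: product_sigma_finite "\<lambda>_::nat. circle_measure" ..

lemma borel_measurable_circle:
  "continuous_on (sphere 0 1) h \<Longrightarrow> h \<in> borel_measurable circle_measure"
  by (simp add: borel_measurable_continuous_on_restrict measurable_cong_sets[OF sets_circle_measure refl])

lemma measurable_circle_ident [measurable]: "(\<lambda>z. z) \<in> borel_measurable circle_measure"
  by (intro borel_measurable_circle continuous_intros)

lemma circle_path_measurable:
  "(\<lambda>t. cis (2 * pi * t)) \<in> uniform_measure lborel {0..1::real} \<rightarrow>\<^sub>M restrict_space borel (sphere 0 1)"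
proof -
  have "(\<lambda>t::real. cis (2 * pi * t)) \<in> borel_measurable borel"
    by (intro borel_measurable_continuous_onI continuous_intros)
  then show ?thesis by (intro measurable_restrict_space2) auto
qed

lemma integral_circle:
  fixes h :: "complex \<Rightarrow> 'b::euclidean_space"
  assumes h: "continuous_on (sphere 0 1) h"
  shows "integral\<^sup>L circle_measure h = integral {0..1} (\<lambda>t. h (cis (2 * pi * t)))"
proof -
  have c: "continuous_on {0..1} (\<lambda>t. h (cis (2 * pi * t)))"
    by (rule continuous_on_compose2[OF h]) (auto intro!: continuous_intros)
  have "integral\<^sup>L circle_measure h = (LINT t|uniform_measure lborel {0..1::real}. h (cis (2 * pi * t)))"
    unfolding circle_measure_def
    by (rule integral_distr[OF circle_path_measurable borel_measurable_continuous_on_restrict[OF h]])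
  also have "\<dots> = (LINT t|density lborel (\<lambda>x. ennreal (indicator {0..1::real} x)). h (cis (2 * pi * t)))"
    unfolding uniform_measure_def by (simp add: divide_ennreal_def ennreal_indicator)
  also have "\<dots> = (LINT t|lborel. indicator {0..1::real} t *\<^sub>R h (cis (2 * pi * t)))"
  proof (rule integral_density)
    have hm: "h \<in> borel_measurable (restrict_space borel (sphere 0 1))"
      by (rule borel_measurable_continuous_on_restrict[OF h])
    show "(\<lambda>t. h (cis (2 * pi * t))) \<in> borel_measurable lborel"
      using measurable_compose[OF circle_path_measurable hm]
      by (simp add: measurable_cong_sets[OF sets_uniform_measure refl])
  qed auto
  also have "\<dots> = (LINT t:{0..1}|lborel. h (cis (2 * pi * t)))"
    by (simp add: set_lebesgue_integral_def)
  also have "\<dots> = integral {0..1} (\<lambda>t. h (cis (2 * pi * t)))"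
    by (rule set_borel_integral_eq_integral(2)[OF borel_integrable_atLeastAtMost'[OF c]])
  finally show ?thesis .
qed

lemma unit_eq_cis:
  assumes "cmod u = 1"
  obtains a where "0 \<le> a" "a \<le> 1" "u = cis (2 * pi * a)"
proof (rule that[of "Arg2pi u / (2 * pi)"])
  show "0 \<le> Arg2pi u / (2 * pi)" "Arg2pi u / (2 * pi) \<le> 1" using Arg2pi[of u] by auto
  show "u = cis (2 * pi * (Arg2pi u / (2 * pi)))"
    using Arg2pi_eq[of u] assms by (simp add: cis_conv_exp)
qed

lemma integral_circle_rotate:
  fixes h :: "complex \<Rightarrow> 'b::euclidean_space"
  assumes h: "continuous_on (sphere 0 1) h" and u: "cmod u = 1"
  shows "(LINT z|circle_measure. h (u * z)) = (LINT z|circle_measure. h z)"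
proof -
  obtain a where a: "0 \<le> a" "a \<le> 1" and ua: "u = cis (2 * pi * a)"
    using unit_eq_cis[OF u] by blast
  have "continuous_on (sphere 0 1) (\<lambda>z. h (u * z))"
    by (rule continuous_on_compose2[OF h]) (auto intro!: continuous_intros simp: norm_mult u)
  then have "(LINT z|circle_measure. h (u * z)) = integral {0..1} (\<lambda>t. h (u * cis (2 * pi * t)))"
    by (rule integral_circle)
  also have "\<dots> = integral {0..1} (\<lambda>t. h (cis (2 * pi * (t + a))))"
    by (simp add: ua cis_mult algebra_simps)
  also have "\<dots> = integral {0..1} (\<lambda>t. h (cis (2 * pi * t)))"
  proof (rule integral_shift_periodic[OF _ _ a])
    show "continuous_on UNIV (\<lambda>t. h (cis (2 * pi * t)))"
      by (rule continuous_on_compose2[OF h]) (auto intro!: continuous_intros)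
    show "h (cis (2 * pi * (t + 1))) = h (cis (2 * pi * t))" for t
      by (simp add: distrib_left flip: cis_mult)
  qed
  also have "\<dots> = (LINT z|circle_measure. h z)"
    by (rule integral_circle[OF h, symmetric])
  finally show ?thesis .
qed

text \<open>Rotation by a \<open>u\<close> with \<open>u powi n = -1\<close> shows that the integral
  equals its own negative.\<close>

lemma integral_circle_powi:
  assumes "n \<noteq> 0"
  shows "(LINT z|circle_measure. z powi n) = 0"
proof -
  have c: "continuous_on (sphere 0 1) (\<lambda>z::complex. z powi n)"
    by (intro continuous_intros) auto
  define u where "u = cis (pi / of_int n)"
  have u: "u powi n = -1"
    using assms by (simp add: u_def cis_power_int)
  have "(LINT z|circle_measure. z powi n) = (LINT z|circle_measure. (u * z) powi n)"
    by (rule integral_circle_rotate[OF c, symmetric]) (simp add: u_def)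
  also have "\<dots> = - (LINT z|circle_measure. z powi n)"
    by (simp add: power_int_mult_distrib u)
  finally show ?thesis by simp
qed

lemma exists_unit_rotation: "\<exists>u. cmod u = 1 \<and> z = of_real (cmod z) * u"
proof (cases "z = 0")
  case True
  then show ?thesis by (intro exI[of _ 1]) simp
next
  case False
  then show ?thesis by (intro exI[of _ "z / of_real (cmod z)"]) (simp add: norm_divide)
qed

text \<open>The phases \<open>u\<close> of \<open>x\<close> and \<open>v\<close> of \<open>w\<close>
  disappear on rotating the variable by \<open>v / u\<close> and taking \<open>v\<close> out of the
  modulus.\<close>

lemma integral_circle_translate:
  assumes f: "continuous_on {0..} (f :: real \<Rightarrow> real)"
  shows "(LINT z|circle_measure. f ((cmod (x * z + w))\<^sup>2)) = circle_mean f (cmod w) ((cmod x)\<^sup>2)"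
proof -
  obtain u where u: "cmod u = 1" "x = of_real (cmod x) * u" using exists_unit_rotation by blast
  obtain v where v: "cmod v = 1" "w = of_real (cmod w) * v" using exists_unit_rotation by blast
  have c: "continuous_on (sphere 0 1) (\<lambda>z. f ((cmod (x * z + w))\<^sup>2))" for x w
    by (rule continuous_on_compose2[OF f]) (auto intro!: continuous_intros)
  have cm: "(cmod (x * (v / u * z) + w))\<^sup>2 = (cmod (of_real (cmod x) * z + of_real (cmod w)))\<^sup>2" for z
  proof -
    have "x * (v / u * z) + w = v * (of_real (cmod x) * z + of_real (cmod w))"
    proof -
      have "u \<noteq> 0" using u(1) by auto
      then have "of_real (cmod x) * u * (v / u * z) + of_real (cmod w) * v
          = v * (of_real (cmod x) * z + of_real (cmod w))"
        by (simp add: algebra_simps)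
      then show ?thesis by (simp only: flip: u(2) v(2))
    qed
    then show ?thesis by (simp add: norm_mult v(1))
  qed
  have "(LINT z|circle_measure. f ((cmod (x * z + w))\<^sup>2))
      = (LINT z|circle_measure. f ((cmod (x * (v / u * z) + w))\<^sup>2))"
    by (rule integral_circle_rotate[OF c, symmetric]) (simp add: norm_divide u(1) v(1))
  also have "\<dots> = (LINT z|circle_measure. f ((cmod (of_real (cmod x) * z + of_real (cmod w)))\<^sup>2))"
    by (simp only: cm)
  also have "\<dots> = integral {0..1} (\<lambda>t. f ((cmod (of_real (cmod x) * cis (2 * pi * t) + of_real (cmod w)))\<^sup>2))"
    by (rule integral_circle[OF c])
  also have "\<dots> = circle_mean f (cmod w) ((cmod x)\<^sup>2)"
  proof -
    have "(cmod (of_real (cmod x) * cis (2 * pi * t) + of_real (cmod w)))\<^sup>2 = chord (cmod w) ((cmod x)\<^sup>2) t" for t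
    proof -
      have "(cmod (of_real (cmod x) * cis (2 * pi * t) + of_real (cmod w)))\<^sup>2
         = (cmod x * cos (2 * pi * t) + cmod w)\<^sup>2 + (cmod x * sin (2 * pi * t))\<^sup>2"
        by (simp add: cmod_power2)
      also have "\<dots> = chord (cmod w) ((cmod x)\<^sup>2) t"
        by (simp add: chord_def power2_sum power_mult_distrib sin_squared_eq algebra_simps)
      finally show ?thesis .
    qed
    then show ?thesis by (simp only: circle_mean_def)
  qed
  finally show ?thesis .
qed

lemma continuous_on_nonneg_bounded_initial:
  assumes f: "continuous_on {0..} (f :: real \<Rightarrow> real)"
  obtains C where "\<And>u. 0 \<le> u \<Longrightarrow> u \<le> B \<Longrightarrow> norm (f u) \<le> C"
proof -
  have "compact (f ` {0..B})"
    by (intro compact_continuous_image continuous_on_subset[OF f]) auto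
  then obtain C where "\<forall>y\<in>f ` {0..B}. norm y \<le> C"
    using compact_imp_bounded bounded_iff by metis
  then have "norm (f u) \<le> C" if "0 \<le> u" "u \<le> B" for u using that by simp
  then show thesis by (rule that)
qed

text \<open>Substituting \<open>z\<^sub>2 \<rightarrow> z\<^sub>1 z\<^sub>2\<close> makes \<open>x z\<^sub>1 + y z\<^sub>2 = z\<^sub>1 (x + y z\<^sub>2)\<close>, so that \<open>z\<^sub>1\<close> only rotates.\<close>

lemma integral_bicircle:
  assumes f: "continuous_on {0..} (f :: real \<Rightarrow> real)"
  shows "(LINT z1|circle_measure. LINT z2|circle_measure. f ((cmod (x * z1 + y * z2 + w))\<^sup>2))
     = bicircle_mean f ((cmod x)\<^sup>2 + (cmod y)\<^sup>2) (cmod x * cmod y) (cmod w)"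
proof -
  let ?F = "\<lambda>z1 z2. f ((cmod ((y * z2 + x) * z1 + w))\<^sup>2)"
  have "(LINT z1|circle_measure. LINT z2|circle_measure. f ((cmod (x * z1 + y * z2 + w))\<^sup>2))
     = (LINT z1|circle_measure. LINT z2|circle_measure. ?F z1 z2)"
  proof (rule Bochner_Integration.integral_cong[OF refl])
    fix z1 assume "z1 \<in> space circle_measure"
    then have z1: "cmod z1 = 1" by simp
    have "continuous_on (sphere 0 1) (\<lambda>z. f ((cmod (x * z1 + y * z + w))\<^sup>2))"
      by (rule continuous_on_compose2[OF f]) (auto intro!: continuous_intros)
    from integral_circle_rotate[OF this z1]
    show "(LINT z2|circle_measure. f ((cmod (x * z1 + y * z2 + w))\<^sup>2)) = (LINT z2|circle_measure. ?F z1 z2)"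
      by (simp add: algebra_simps)
  qed
  also have "\<dots> = (LINT z2|circle_measure. LINT z1|circle_measure. ?F z1 z2)"
  proof (rule circle_pair.Fubini_integral[symmetric])
    obtain C where C: "\<And>u. 0 \<le> u \<Longrightarrow> u \<le> (cmod x + cmod y + cmod w)\<^sup>2 \<Longrightarrow> norm (f u) \<le> C"
      using continuous_on_nonneg_bounded_initial[OF f] by blast
    have "f \<in> borel_measurable (restrict_space borel {0..})"
      by (rule borel_measurable_continuous_on_restrict[OF f])
    \<comment> \<open>\<open>f\<close> is controlled only on \<open>{0..}\<close>. Composition with
      \<open>max 0\<close> gives a Borel function on the whole line that agrees with
      \<open>f\<close> at squared moduli.\<close>
    then have [measurable]: "(\<lambda>u. f (max 0 u)) \<in> borel_measurable borel"
      by (rule measurable_compose[rotated]) (auto intro!: measurable_restrict_space2)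
    have "integrable (circle_measure \<Otimes>\<^sub>M circle_measure) (\<lambda>(z1, z2). f (max 0 ((cmod ((y * z2 + x) * z1 + w))\<^sup>2)))"
    proof (rule circle_pair.P.integrable_const_bound)
      show "AE z in circle_measure \<Otimes>\<^sub>M circle_measure.
         norm ((\<lambda>(z1, z2). f (max 0 ((cmod ((y * z2 + x) * z1 + w))\<^sup>2))) z) \<le> C"
      proof (rule AE_I2, clarsimp simp: space_pair_measure)
        fix z1 z2 :: complex assume z: "cmod z1 = 1" "cmod z2 = 1"
        have "cmod ((y * z2 + x) * z1 + w) \<le> cmod ((y * z2 + x) * z1) + cmod w" by (rule norm_triangle_ineq)
        also have "cmod ((y * z2 + x) * z1) \<le> cmod x + cmod y"
          using norm_triangle_ineq[of "y * z2" x] by (simp add: norm_mult z)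
        finally show "\<bar>f ((cmod ((y * z2 + x) * z1 + w))\<^sup>2)\<bar> \<le> C"
          using C[of "(cmod ((y * z2 + x) * z1 + w))\<^sup>2"] by (simp add: power_mono)
      qed
    qed measurable
    then show "integrable (circle_measure \<Otimes>\<^sub>M circle_measure) (\<lambda>(z1, z2). ?F z1 z2)" by simp
  qed
  also have "\<dots> = (LINT z2|circle_measure. circle_mean f (cmod w) ((cmod (y * z2 + x))\<^sup>2))"
    by (simp only: integral_circle_translate[OF f])
  \<comment> \<open>The inner mean depends on \<open>z2\<close> only through a squared modulus, so
    the one-circle formula applies again, with centre \<open>x\<close> and radius
    \<open>cmod y\<close>.\<close>
  also have "\<dots> = circle_mean (circle_mean f (cmod w)) (cmod x) ((cmod y)\<^sup>2)"
    by (rule integral_circle_translate[OF continuous_on_circle_mean[OF f]])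
  also have "\<dots> = bicircle_mean f ((cmod x)\<^sup>2 + (cmod y)\<^sup>2) (cmod x * cmod y) (cmod w)"
    by (simp add: circle_mean_def[of "circle_mean f (cmod w)"] bicircle_mean_def chord_def mult.assoc)
  finally show ?thesis .
qed

section \<open>Linear forms on finite products of circles\<close>

lemma measurable_component_circle:
  assumes "i \<in> J"
  shows "(\<lambda>z. z i) \<in> borel_measurable (PiM J (\<lambda>_::nat. circle_measure))"
  using measurable_compose[OF measurable_component_singleton[OF assms] measurable_circle_ident] .

lemma measurable_linear_form [measurable]:
  "(\<lambda>z. \<Sum>i\<in>J. c i * z i) \<in> borel_measurable (PiM J (\<lambda>_::nat. circle_measure))"
  by (intro borel_measurable_sum borel_measurable_times measurable_component_circle) auto

lemma norm_component_PiM_circle: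
  "z \<in> space (PiM J (\<lambda>_::nat. circle_measure)) \<Longrightarrow> i \<in> J \<Longrightarrow> cmod (z i) = 1"
  by (auto simp: space_PiM PiE_def Pi_def)

lemma norm_linear_form_le:
  assumes "z \<in> space (PiM J (\<lambda>_::nat. circle_measure))"
  shows "cmod (\<Sum>i\<in>J. c i * z i) \<le> (\<Sum>i\<in>J. cmod (c i))"
  by (rule sum_norm_le) (simp add: norm_mult norm_component_PiM_circle[OF assms])

lemma measurable_compose_max:
  assumes f: "continuous_on {0..} (f :: real \<Rightarrow> real)"
  shows "(\<lambda>u. f (max 0 u)) \<in> borel_measurable borel"
  by (intro borel_measurable_continuous_onI continuous_on_compose2[OF f] continuous_intros) auto

lemma bicircle_mean_bounded:
  assumes f: "continuous_on {0..} f" and C: "\<And>u. 0 \<le> u \<Longrightarrow> u \<le> B\<^sup>2 \<Longrightarrow> norm (f u) \<le> C"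
    and "0 \<le> a" "0 \<le> b" "0 \<le> r" "a + b + r \<le> B"
  shows "norm (bicircle_mean f (a\<^sup>2 + b\<^sup>2) (a * b) r) \<le> C"
proof -
  have ab: "0 \<le> a * b" "2 * (a * b) \<le> a\<^sup>2 + b\<^sup>2"
    using assms sum_squares_bound[of a b] by auto
  have "a\<^sup>2 + b\<^sup>2 + 2 * (a * b) = (a + b)\<^sup>2" by (simp add: power2_sum)
  then have "sqrt (a\<^sup>2 + b\<^sup>2 + 2 * (a * b)) = a + b" using assms by simp
  then have le: "(r + sqrt (a\<^sup>2 + b\<^sup>2 + 2 * (a * b)))\<^sup>2 \<le> B\<^sup>2"
    using assms by (intro power_mono) auto
  have C': "- C \<le> f u" "f u \<le> C" if "0 \<le> u" "u \<le> (r + sqrt (a\<^sup>2 + b\<^sup>2 + 2 * (a * b)))\<^sup>2" for u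
    using C[of u] that le by auto
  have "bicircle_mean (\<lambda>_. - C) (a\<^sup>2 + b\<^sup>2) (a * b) r \<le> bicircle_mean f (a\<^sup>2 + b\<^sup>2) (a * b) r"
    by (rule bicircle_mean_mono[OF _ f assms(5) ab C'(1)]) auto
  moreover have "bicircle_mean f (a\<^sup>2 + b\<^sup>2) (a * b) r \<le> bicircle_mean (\<lambda>_. C) (a\<^sup>2 + b\<^sup>2) (a * b) r"
    by (rule bicircle_mean_mono[OF f _ assms(5) ab C'(2)]) auto
  ultimately show ?thesis by auto
qed

text \<open>The variables \<open>j\<close> and \<open>k\<close> are split off by Fubini and averaged
  with \<open>integral_bicircle\<close>; the rest of the form plays the role of \<open>w\<close>.
  This isolates the only two coefficients that will be varied.\<close>

lemma
  fixes c :: "nat \<Rightarrow> complex" and f :: "real \<Rightarrow> real"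
  assumes f: "continuous_on {0..} f" and I: "finite I" "j \<notin> I" "k \<notin> I" "j \<noteq> k"
  defines "G \<equiv> \<lambda>z. bicircle_mean f ((cmod (c j))\<^sup>2 + (cmod (c k))\<^sup>2) (cmod (c j) * cmod (c k)) (cmod (\<Sum>i\<in>I. c i * z i))"
    and "J \<equiv> insert j (insert k I)"
  shows integral_linear_form_eq: "(LINT z|PiM J (\<lambda>_. circle_measure). f ((cmod (\<Sum>i\<in>J. c i * z i))\<^sup>2))
      = (LINT z|PiM I (\<lambda>_. circle_measure). G z)" (is ?eq)
    and integrable_bicircle_linear_form: "integrable (PiM I (\<lambda>_. circle_measure)) G" (is ?int)
proof -
  let ?P = "\<lambda>J. PiM J (\<lambda>_::nat. circle_measure)"
  let ?W = "\<lambda>z. \<Sum>i\<in>I. c i * z i"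
  define g where "g = (\<lambda>u. f (max 0 u))"
  have fg: "f (x\<^sup>2) = g (x\<^sup>2)" for x by (simp add: g_def)
  have g [measurable]: "g \<in> borel_measurable borel"
    unfolding g_def by (rule measurable_compose_max[OF f])
  define B where "B = (\<Sum>i\<in>J. cmod (c i))"
  have B: "B = cmod (c j) + (cmod (c k) + (\<Sum>i\<in>I. cmod (c i)))"
    unfolding B_def J_def using I by simp
  obtain C where C: "\<And>u. 0 \<le> u \<Longrightarrow> u \<le> B\<^sup>2 \<Longrightarrow> norm (f u) \<le> C"
    using continuous_on_nonneg_bounded_initial[OF f] by blast
  have gC: "norm (g (x\<^sup>2)) \<le> C" if "0 \<le> x" "x \<le> B" for x
    unfolding fg[symmetric] using that by (intro C power_mono) auto
  have W_meas [measurable]: "?W \<in> borel_measurable (?P (insert k I))"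
  proof -
    \<comment> \<open>\<open>measurable_linear_form\<close> sums over the whole index set of the
      product, so the missing term is supplied with coefficient 0.\<close>
    have "(\<lambda>z. \<Sum>i\<in>insert k I. (c(k := 0)) i * z i) \<in> borel_measurable (?P (insert k I))"
      by (rule measurable_linear_form)
    also have "(\<lambda>z. \<Sum>i\<in>insert k I. (c(k := 0)) i * z i) = ?W"
      using I by (auto simp: fun_eq_iff intro!: sum.cong)
    finally show ?thesis .
  qed
  have k_meas [measurable]: "(\<lambda>z. z k) \<in> borel_measurable (?P (insert k I))"
    by (rule measurable_component_circle) simp
  have W_upd: "?W (z(k := y)) = ?W z" "?W (z(j := y)) = ?W z" for z y
    using I by (auto intro!: sum.cong)
  have J: "(\<Sum>i\<in>J. c i * z i) = c j * z j + (c k * z k + ?W z)" for z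
    unfolding J_def using I by simp
  define h where "h = (\<lambda>z. LINT y|circle_measure. g ((cmod (c j * y + (c k * z k + ?W z)))\<^sup>2))"
  have h_meas: "h \<in> borel_measurable (?P (insert k I))"
    unfolding h_def by measurable
  have le: "cmod (c j * y + (c k * z k + ?W z)) \<le> B"
    if "z \<in> space (?P (insert k I))" "cmod y = 1" for z y
  proof -
    have "cmod (?W z) \<le> (\<Sum>i\<in>I. cmod (c i))"
      by (rule sum_norm_le) (use norm_component_PiM_circle[OF that(1)] in \<open>simp add: norm_mult\<close>)
    moreover have "cmod (c k * z k) = cmod (c k)" "cmod (c j * y) = cmod (c j)"
      using norm_component_PiM_circle[OF that(1)] that(2) by (auto simp: norm_mult)
    ultimately show ?thesis
      using norm_triangle_ineq[of "c j * y" "c k * z k + ?W z"] norm_triangle_ineq[of "c k * z k" "?W z"]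
      unfolding B by linarith
  qed
  interpret P1: prob_space "?P (insert k I)" by (intro prob_space_PiM prob_space_circle_measure)
  interpret PJ: prob_space "?P J" by (intro prob_space_PiM prob_space_circle_measure)
  interpret PI: prob_space "?P I" by (intro prob_space_PiM prob_space_circle_measure)
  have h_circle: "h z = circle_mean f (cmod (c k * z k + ?W z)) ((cmod (c j))\<^sup>2)" for z
    unfolding h_def fg[symmetric] by (rule integral_circle_translate[OF f])
  have int_h: "integrable (?P (insert k I)) h"
  proof (rule P1.integrable_const_bound[OF _ h_meas])
    show "AE z in ?P (insert k I). norm (h z) \<le> C"
    proof (rule AE_I2)
      fix z assume z: "z \<in> space (?P (insert k I))"
      have "norm (h z) \<le> (LINT y|circle_measure. norm (g ((cmod (c j * y + (c k * z k + ?W z)))\<^sup>2)))"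
        unfolding h_def by (rule integral_norm_bound)
      also have "\<dots> \<le> C"
      proof (rule circle.integral_le_const)
        have bound: "norm (g ((cmod (c j * y + (c k * z k + ?W z)))\<^sup>2)) \<le> C" if "y \<in> space circle_measure" for y
          by (rule gC[OF norm_ge_zero le[OF z]]) (use that in simp)
        then show "AE y in circle_measure. norm (g ((cmod (c j * y + (c k * z k + ?W z)))\<^sup>2)) \<le> C"
          by (rule AE_I2)
        show "integrable circle_measure (\<lambda>y. norm (g ((cmod (c j * y + (c k * z k + ?W z)))\<^sup>2)))"
        proof (rule integrable_norm[OF circle.integrable_const_bound])
          show "AE y in circle_measure. norm (g ((cmod (c j * y + (c k * z k + ?W z)))\<^sup>2)) \<le> C"
            by (rule AE_I2[OF bound])
        qed measurable
      qed
      finally show "norm (h z) \<le> C" .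
    qed
  qed
  have "(LINT z|?P J. f ((cmod (\<Sum>i\<in>J. c i * z i))\<^sup>2)) =
      (LINT z|?P (insert k I). LINT y|circle_measure. f ((cmod (\<Sum>i\<in>J. c i * (z(j := y)) i))\<^sup>2))"
    unfolding J_def
  proof (rule circle_prod.product_integral_insert)
    show "integrable (?P (insert j (insert k I))) (\<lambda>z. f ((cmod (\<Sum>i\<in>insert j (insert k I). c i * z i))\<^sup>2))"
      unfolding J_def[symmetric] fg
    proof (rule PJ.integrable_const_bound)
      show "AE z in ?P J. norm (g ((cmod (\<Sum>i\<in>J. c i * z i))\<^sup>2)) \<le> C"
        by (rule AE_I2, rule gC[OF norm_ge_zero]) (simp only: B_def norm_linear_form_le)
    qed measurable
  qed (use I in auto)
  also have "\<dots> = (LINT z|?P (insert k I). h z)"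
    unfolding J W_upd h_def using I by (simp add: fg)
  also have "\<dots> = (LINT z|?P I. LINT y|circle_measure. h (z(k := y)))"
    by (rule circle_prod.product_integral_insert[OF _ _ int_h]) (use I in auto)
  also have hG: "(\<lambda>z. LINT y|circle_measure. h (z(k := y))) = G"
  proof
    fix z
    have "(LINT y|circle_measure. h (z(k := y)))
       = (LINT y|circle_measure. LINT x|circle_measure. f ((cmod (c k * y + c j * x + ?W z))\<^sup>2))"
      unfolding h_def W_upd fg by (simp add: algebra_simps)
    also have "\<dots> = G z"
      unfolding G_def integral_bicircle[OF f] by (simp add: add.commute mult.commute)
    finally show "(LINT y|circle_measure. h (z(k := y))) = G z" .
  qed
  finally show ?eq .
  show ?int
  proof (rule PI.integrable_const_bound)
    \<comment> \<open>Measurability of \<open>G\<close> comes from \<open>hG\<close>, which exhibits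
      it as a parameter integral of the measurable \<open>h\<close>.\<close>
    have "(\<lambda>(z, y). z(k := y)) \<in> ?P I \<Otimes>\<^sub>M circle_measure \<rightarrow>\<^sub>M ?P (insert k I)"
      by (rule measurable_add_dim)
    from measurable_compose[OF this h_meas]
    have "(\<lambda>(z, y). h (z(k := y))) \<in> borel_measurable (?P I \<Otimes>\<^sub>M circle_measure)"
      by (simp add: split_def)
    from circle.borel_measurable_lebesgue_integral[OF this]
    show "G \<in> borel_measurable (?P I)" unfolding hG .
    show "AE z in ?P I. norm (G z) \<le> C"
    proof (rule AE_I2)
      fix z assume "z \<in> space (?P I)"
      from norm_linear_form_le[OF this, of c]
      show "norm (G z) \<le> C"
        unfolding G_def by (intro bicircle_mean_bounded[OF f C, where B=B]) (auto simp: B)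
    qed
  qed
qed

section \<open>Linear forms on the torus\<close>

definition linear_form :: "nat \<Rightarrow> (nat \<Rightarrow> complex) \<Rightarrow> (nat \<Rightarrow> complex) \<Rightarrow> complex" where
  "linear_form d c z = (\<Sum>i = 1..d. c i * z i)"

lemma measurable_linear_form_torus [measurable]: "linear_form d c \<in> borel_measurable (torus d)"
  unfolding torus_def linear_form_def[abs_def] by (rule measurable_linear_form)

lemma norm_component_torus: "z \<in> space (torus d) \<Longrightarrow> i \<in> {1..d} \<Longrightarrow> cmod (z i) = 1"
  unfolding torus_def by (rule norm_component_PiM_circle)

lemma norm_linear_form_torus_le:
  "z \<in> space (torus d) \<Longrightarrow> cmod (linear_form d c z) \<le> (\<Sum>i = 1..d. cmod (c i))"
  unfolding torus_def linear_form_def by (rule norm_linear_form_le)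

lemma integrable_circle_powi: "integrable circle_measure (\<lambda>z. z powi n)"
proof (rule circle.integrable_const_bound)
  show "(\<lambda>z. z powi n) \<in> borel_measurable circle_measure"
    by (intro borel_measurable_circle continuous_intros) auto
  show "AE z in circle_measure. norm (z powi n) \<le> 1"
    by (rule AE_I2) (simp add: norm_power_int)
qed

lemma integral_torus_monomial:
  "(LINT z|torus d. (\<Prod>j = 1..d. z j powi n j)) = (if \<forall>j\<in>{1..d}. n j = 0 then 1 else 0)"
proof -
  have "(LINT z|torus d. (\<Prod>j = 1..d. z j powi n j)) = (\<Prod>j = 1..d. (LINT z|circle_measure. z powi n j))"
    unfolding torus_def
    by (rule circle_prod.product_integral_prod) (auto intro: integrable_circle_powi)
  also have "\<dots> = (\<Prod>j = 1..d. if n j = 0 then 1 else 0)"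
    by (rule prod.cong) (auto simp: integral_circle_powi circle.prob_space simp del: space_circle_measure)
  also have "\<dots> = (if \<forall>j\<in>{1..d}. n j = 0 then 1 else 0)"
    by (auto simp: prod_zero_iff)
  finally show ?thesis .
qed

lemma integrable_torus_monomial: "integrable (torus d) (\<lambda>z. \<Prod>j = 1..d. z j powi n j)"
  unfolding torus_def
  by (rule circle_prod.product_integrable_prod) (auto intro: integrable_circle_powi)

text \<open>Conjugation is inversion on the circle, so the integrand is a combination of Laurent
  monomials, and only the trivial one has a nonzero integral. The condition is confined to
  \<open>{1..d}\<close> because \<open>\<alpha>\<close> is arbitrary elsewhere.\<close>

lemma fourier_coeff_linear_form:
  "fourier_coeff d (linear_form d e) \<alpha> =
    (\<Sum>i = 1..d. if \<forall>j\<in>{1..d}. \<alpha> j = (if j = i then 1 else 0) then e i else 0)"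
proof -
  have eq: "linear_form d e z * cnj (\<Prod>j = 1..d. z j powi \<alpha> j)
      = (\<Sum>i = 1..d. e i * (\<Prod>j = 1..d. z j powi ((if j = i then 1 else 0) - \<alpha> j)))"
    if z: "z \<in> space (torus d)" for z
  proof -
    have nz: "z j \<noteq> 0" if "j \<in> {1..d}" for j
      using norm_component_torus[OF z that] by auto
    have cnj: "cnj (z j powi \<alpha> j) = inverse (z j powi \<alpha> j)" if "j \<in> {1..d}" for j
    proof -
      have "cmod (z j powi \<alpha> j) = 1"
        using norm_component_torus[OF z that] by (simp add: norm_power_int)
      then show ?thesis
        using complex_norm_square[of "z j powi \<alpha> j"] inverse_unique[of "z j powi \<alpha> j" "cnj (z j powi \<alpha> j)"]
        by simp
    qed
    have "e i * z i * cnj (\<Prod>j = 1..d. z j powi \<alpha> j)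
        = e i * (\<Prod>j = 1..d. z j powi ((if j = i then 1 else 0) - \<alpha> j))" if i: "i \<in> {1..d}" for i
    proof -
      have "(\<Prod>j = 1..d. z j powi ((if j = i then 1 else 0) - \<alpha> j))
         = (\<Prod>j = 1..d. (if j = i then z j else 1) * cnj (z j powi \<alpha> j))"
        by (rule prod.cong) (use nz cnj in \<open>auto simp: power_int_diff divide_inverse\<close>)
      also have "\<dots> = z i * cnj (\<Prod>j = 1..d. z j powi \<alpha> j)"
        using i by (simp add: prod.distrib)
      finally show ?thesis by simp
    qed
    then show ?thesis unfolding linear_form_def sum_distrib_right by (intro sum.cong refl)
  qed
  have "fourier_coeff d (linear_form d e) \<alpha> =
      (LINT z|torus d. (\<Sum>i = 1..d. e i * (\<Prod>j = 1..d. z j powi ((if j = i then 1 else 0) - \<alpha> j))))"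
    unfolding fourier_coeff_def by (rule Bochner_Integration.integral_cong[OF refl eq])
  also have "\<dots> = (\<Sum>i = 1..d. e i * (LINT z|torus d. (\<Prod>j = 1..d. z j powi ((if j = i then 1 else 0) - \<alpha> j))))"
    by (subst Bochner_Integration.integral_sum, rule integrable_mult_right, rule integrable_torus_monomial) simp
  also have "\<dots> = (\<Sum>i = 1..d. if \<forall>j\<in>{1..d}. \<alpha> j = (if j = i then 1 else 0) then e i else 0)"
    unfolding integral_torus_monomial by (rule sum.cong) (auto split: if_splits)
  finally show ?thesis .
qed

lemma integrable_linear_form_monomial:
  assumes "l \<in> {1..d}"
  shows "integrable (torus d) (\<lambda>z. linear_form d e z * cnj (z l))"
proof -
  interpret T: prob_space "torus d" by (rule prob_space_torus)
  show ?thesis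
  proof (rule T.integrable_const_bound)
    have "(\<lambda>z. z l) \<in> borel_measurable (torus d)"
      unfolding torus_def using assms by (rule measurable_component_circle)
    then have [measurable]: "(\<lambda>z. cnj (z l)) \<in> borel_measurable (torus d)"
      by (rule borel_measurable_continuous_on[rotated]) (intro continuous_intros)
    show "(\<lambda>z. linear_form d e z * cnj (z l)) \<in> borel_measurable (torus d)" by measurable
    show "AE z in torus d. norm (linear_form d e z * cnj (z l)) \<le> (\<Sum>i = 1..d. cmod (e i))"
      by (rule AE_I2) (use norm_linear_form_torus_le norm_component_torus assms in \<open>simp add: norm_mult\<close>)
  qed
qed

text \<open>Pairing with the \<open>l\<close>-th variable is the Fourier coefficient at the
  \<open>l\<close>-th unit vector, that is \<open>e l\<close>; the conjugated form is then
  expanded.\<close>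

lemma torus_inner_linear_form:
  "torus_inner d (linear_form d e) (linear_form d c) = (\<Sum>i = 1..d. e i * cnj (c i))"
proof -
  have mono: "(\<Prod>j = 1..d. z j powi (if j = l then 1 else 0)) = z l" if "l \<in> {1..d}" for l and z :: "nat \<Rightarrow> complex"
  proof -
    have "(\<Prod>j = 1..d. z j powi (if j = l then 1 else 0)) = (\<Prod>j = 1..d. if j = l then z j else 1)"
      by (rule prod.cong) auto
    then show ?thesis using that by simp
  qed
  have coeff: "(LINT z|torus d. linear_form d e z * cnj (z l)) = e l" if l: "l \<in> {1..d}" for l
  proof -
    have "(LINT z|torus d. linear_form d e z * cnj (z l)) = fourier_coeff d (linear_form d e) (\<lambda>j. if j = l then 1 else 0)"
      unfolding fourier_coeff_def mono[OF l] ..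
    also have "\<dots> = (\<Sum>i = 1..d. if i = l then e i else 0)"
      unfolding fourier_coeff_linear_form by (rule sum.cong) (use l in auto)
    finally show ?thesis using l by simp
  qed
  have "torus_inner d (linear_form d e) (linear_form d c)
      = (LINT z|torus d. (\<Sum>l = 1..d. cnj (c l) * (linear_form d e z * cnj (z l))))"
    unfolding torus_inner_def
    by (simp add: linear_form_def[of d c] cnj_sum sum_distrib_left mult_ac)
  also have "\<dots> = (\<Sum>l = 1..d. cnj (c l) * (LINT z|torus d. linear_form d e z * cnj (z l)))"
    by (subst Bochner_Integration.integral_sum) (auto intro!: integrable_mult_right integrable_linear_form_monomial)
  also have "\<dots> = (\<Sum>l = 1..d. e l * cnj (c l))"
    by (rule sum.cong) (simp_all add: coeff)
  finally show ?thesis .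
qed

lemma linear_form_in_Lp_space:
  assumes "2 < p"
  shows "linear_form d e \<in> Lp_space (torus d) p"
proof -
  interpret T: prob_space "torus d" by (rule prob_space_torus)
  let ?B = "\<Sum>i = 1..d. cmod (e i)"
  show ?thesis
  proof (cases "p = \<infinity>")
    case True
    have "AE z in torus d. cmod (linear_form d e z) \<le> ?B"
      by (rule AE_I2) (rule norm_linear_form_torus_le)
    then show ?thesis using True by (auto simp: Lp_space_def)
  next
    case False
    then have P: "0 \<le> real_of_ereal p" using assms by (cases p) auto
    have "integrable (torus d) (\<lambda>z. cmod (linear_form d e z) powr real_of_ereal p)"
    proof (rule T.integrable_const_bound)
      show "AE z in torus d. norm (cmod (linear_form d e z) powr real_of_ereal p) \<le> ?B powr real_of_ereal p"
        by (rule AE_I2) (use P norm_linear_form_torus_le in \<open>auto intro!: powr_mono2\<close>)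
    qed measurable
    then show ?thesis using False by (auto simp: Lp_space_def)
  qed
qed

lemma linear_form_in_hardy_space:
  assumes "2 < p"
  shows "linear_form d e \<in> hardy_space d p"
proof -
  have "fourier_coeff d (linear_form d e) \<alpha> = 0" if "j \<in> {1..d}" "\<alpha> j < 0" for \<alpha> j
    unfolding fourier_coeff_linear_form
  proof (rule sum.neutral, rule ballI)
    fix i
    have "\<not> (\<forall>j\<in>{1..d}. \<alpha> j = (if j = i then 1 else 0))"
      using that by (metis less_numeral_extra(3) not_one_less_zero)
    then show "(if \<forall>j\<in>{1..d}. \<alpha> j = (if j = i then 1 else 0) then e i else 0) = 0" by (simp only: if_False)
  qed
  then show ?thesis using linear_form_in_Lp_space[OF assms] by (auto simp: hardy_space_def)
qed

text \<open>The hypothesis on \<open>c'\<close> says that the form of \<open>c' - c\<close> is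
  orthogonal to that of \<open>c\<close>. This reduces the Hilbert point property to a comparison
  among linear forms.\<close>

lemma hilbert_point_linear_form_le:
  assumes "2 < p" "hilbert_point d p (linear_form d c)"
    and "(\<Sum>i = 1..d. c' i * cnj (c i)) = (\<Sum>i = 1..d. c i * cnj (c i))"
  shows "Lp_norm (torus d) p (linear_form d c) \<le> Lp_norm (torus d) p (linear_form d c')"
proof -
  define e where "e = (\<lambda>i. c' i - c i)"
  have "torus_inner d (linear_form d e) (linear_form d c) = 0"
    unfolding torus_inner_linear_form using assms(3) by (simp add: e_def left_diff_distrib sum_subtractf)
  then have "Lp_norm (torus d) p (linear_form d c) \<le> Lp_norm (torus d) p (\<lambda>z. linear_form d c z + linear_form d e z)"
    using assms(2) linear_form_in_hardy_space[OF assms(1)] unfolding hilbert_point_def by blast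
  also have "(\<lambda>z. linear_form d c z + linear_form d e z) = linear_form d c'"
    by (simp add: e_def linear_form_def fun_eq_iff left_diff_distrib sum_subtractf)
  finally show ?thesis .
qed

section \<open>Finite exponents\<close>

definition power_moment :: "nat \<Rightarrow> real \<Rightarrow> (nat \<Rightarrow> complex) \<Rightarrow> real" where
  "power_moment d P c = (LINT z|torus d. cmod (linear_form d c z) powr P)"

lemma power_moment_nonneg: "0 \<le> power_moment d P c"
  by (simp add: power_moment_def)

lemma power_moment_scale:
  assumes "0 \<le> s"
  shows "power_moment d P (\<lambda>i. of_real s * c i) = s powr P * power_moment d P c"
proof -
  have "linear_form d (\<lambda>i. of_real s * c i) z = of_real s * linear_form d c z" for z
    by (simp add: linear_form_def sum_distrib_left mult.assoc)
  then have "cmod (linear_form d (\<lambda>i. of_real s * c i) z) powr P = s powr P * cmod (linear_form d c z) powr P" for z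
    using assms by (simp add: norm_mult powr_mult)
  then show ?thesis by (simp add: power_moment_def)
qed

lemma Lp_norm_le_imp_power_moment_le:
  assumes "0 < P" "Lp_norm (torus d) (ereal P) (linear_form d c) \<le> Lp_norm (torus d) (ereal P) (linear_form d c')"
  shows "power_moment d P c \<le> power_moment d P c'"
proof (rule ccontr)
  assume "\<not> ?thesis"
  then have "power_moment d P c' powr (1 / P) < power_moment d P c powr (1 / P)"
    using assms(1) power_moment_nonneg[of d P c'] by (intro powr_less_mono2) auto
  then show False using assms(2) by (simp add: Lp_norm_def power_moment_def)
qed

text \<open>Integrates the two-circle gap over the other variables. Their part of the form has
  modulus at most \<open>R\<close> everywhere, so one \<open>D\<close> serves every point and every
  competitor \<open>c'\<close>.\<close>

lemma power_moment_gap: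
  fixes c :: "nat \<Rightarrow> complex" and P :: real
  assumes P: "2 < P" and jk: "j \<in> {1..d}" "k \<in> {1..d}" "j \<noteq> k"
    and m: "m = (cmod (c j))\<^sup>2 + (cmod (c k))\<^sup>2" and K: "K = cmod (c j) * cmod (c k)"
    and pos: "0 < K" "2 * K < m"
  obtains D where "0 < D"
    "\<And>c'. (\<And>i. i \<in> {1..d} - {j, k} \<Longrightarrow> c' i = c i) \<Longrightarrow> (cmod (c' j))\<^sup>2 + (cmod (c' k))\<^sup>2 = m \<Longrightarrow>
      cmod (c' j) * cmod (c' k) \<le> K \<Longrightarrow>
      power_moment d P c' \<le> power_moment d P c - (1 - cmod (c' j) * cmod (c' k) / K) * D"
proof -
  define I where "I = {1..d} - {j, k}"
  have I: "finite I" "j \<notin> I" "k \<notin> I" "j \<noteq> k" using jk by (auto simp: I_def)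
  have J: "{1..d} = insert j (insert k I)" using jk by (auto simp: I_def)
  let ?f = "\<lambda>u::real. u powr (P / 2)"
  let ?PI = "PiM I (\<lambda>_. circle_measure)"
  interpret PI: prob_space ?PI by (intro prob_space_PiM prob_space_circle_measure)
  have f: "continuous_on {0..} ?f"
    using continuous_on_shifted_powr[of "P / 2" 0] P by simp
  have sq: "?f (x\<^sup>2) = x powr P" if "0 \<le> x" for x
    using that powr_powr[of x 2 "P / 2"] by (cases "x = 0") auto
  define R where "R = (\<Sum>i\<in>I. cmod (c i))"
  have R: "0 \<le> R" by (simp add: R_def sum_nonneg)
  obtain D where D: "0 < D" and gap: "\<And>r k'. 0 \<le> r \<Longrightarrow> r \<le> R \<Longrightarrow> 0 \<le> k' \<Longrightarrow> k' \<le> K \<Longrightarrow>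
      bicircle_mean ?f m k' r \<le> bicircle_mean ?f m K r - (1 - k' / K) * D"
    using bicircle_mean_powr_gap[of "P / 2" R K m] P R pos by auto
  have eq: "power_moment d P c' = (LINT z|?PI. bicircle_mean ?f ((cmod (c' j))\<^sup>2 + (cmod (c' k))\<^sup>2)
      (cmod (c' j) * cmod (c' k)) (cmod (\<Sum>i\<in>I. c' i * z i)))" for c'
    unfolding power_moment_def torus_def linear_form_def J integral_linear_form_eq[OF f I, symmetric]
    by (simp add: sq)
  show thesis
  proof (rule that[OF D])
    fix c' assume same: "\<And>i. i \<in> {1..d} - {j, k} \<Longrightarrow> c' i = c i"
      and m': "(cmod (c' j))\<^sup>2 + (cmod (c' k))\<^sup>2 = m" and K': "cmod (c' j) * cmod (c' k) \<le> K"
    define k' where "k' = cmod (c' j) * cmod (c' k)"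
    have W: "(\<Sum>i\<in>I. c' i * z i) = (\<Sum>i\<in>I. c i * z i)" for z
      by (rule sum.cong) (auto simp: same I_def)
    have int': "integrable ?PI (\<lambda>z. bicircle_mean ?f m k' (cmod (\<Sum>i\<in>I. c i * z i)))"
      using integrable_bicircle_linear_form[OF f I, of c'] by (simp add: m' k'_def W)
    have int: "integrable ?PI (\<lambda>z. bicircle_mean ?f m K (cmod (\<Sum>i\<in>I. c i * z i)))"
      using integrable_bicircle_linear_form[OF f I, of c] by (simp add: m K)
    have "power_moment d P c' = (LINT z|?PI. bicircle_mean ?f m k' (cmod (\<Sum>i\<in>I. c i * z i)))"
      unfolding eq W m' k'_def ..
    also have "\<dots> \<le> (LINT z|?PI. bicircle_mean ?f m K (cmod (\<Sum>i\<in>I. c i * z i)) - (1 - k' / K) * D)"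
    proof (rule integral_mono[OF int'])
      show "integrable ?PI (\<lambda>z. bicircle_mean ?f m K (cmod (\<Sum>i\<in>I. c i * z i)) - (1 - k' / K) * D)"
        using int by (intro Bochner_Integration.integrable_diff) auto
      fix z assume "z \<in> space ?PI"
      then have "cmod (\<Sum>i\<in>I. c i * z i) \<le> R" unfolding R_def by (rule norm_linear_form_le)
      then show "bicircle_mean ?f m k' (cmod (\<Sum>i\<in>I. c i * z i))
         \<le> bicircle_mean ?f m K (cmod (\<Sum>i\<in>I. c i * z i)) - (1 - k' / K) * D"
        using K' by (intro gap) (auto simp: k'_def)
    qed
    also have "\<dots> = (LINT z|?PI. bicircle_mean ?f m K (cmod (\<Sum>i\<in>I. c i * z i))) - (1 - k' / K) * D"
      using int by (subst Bochner_Integration.integral_diff) (auto simp: PI.prob_space)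
    also have "\<dots> = power_moment d P c - (1 - k' / K) * D"
      unfolding eq by (simp add: m K)
    finally show "power_moment d P c' \<le> power_moment d P c - (1 - cmod (c' j) * cmod (c' k) / K) * D"
      by (simp add: k'_def)
  qed
qed

lemma hilbert_point_linear_form_not_less_finite:
  fixes c :: "nat \<Rightarrow> complex" and P :: real
  assumes P: "2 < P" and hp: "hilbert_point d (ereal P) (linear_form d c)"
    and jk: "j \<in> {1..d}" "k \<in> {1..d}" and ck: "c k \<noteq> 0" and less: "cmod (c k) < cmod (c j)"
  shows False
proof -
  have "j \<noteq> k" using less by auto
  define a b where "a = cmod (c j)" and "b = cmod (c k)"
  have ab: "0 < b" "b < a" "0 < a" using ck less by (auto simp: a_def b_def intro: order.strict_trans2[OF _ less_imp_le])
  have sq: "0 < a\<^sup>2 - b\<^sup>2" "2 * (a * b) < a\<^sup>2 + b\<^sup>2"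
  proof -
    have "0 < (a - b) * (a + b)" "0 < (a - b) * (a - b)" using ab by auto
    then show "0 < a\<^sup>2 - b\<^sup>2" "2 * (a * b) < a\<^sup>2 + b\<^sup>2" by (auto simp: power2_eq_square algebra_simps)
  qed
  obtain D where D: "0 < D" and gap:
    "\<And>c'. (\<And>i. i \<in> {1..d} - {j, k} \<Longrightarrow> c' i = c i) \<Longrightarrow> (cmod (c' j))\<^sup>2 + (cmod (c' k))\<^sup>2 = a\<^sup>2 + b\<^sup>2 \<Longrightarrow>
      cmod (c' j) * cmod (c' k) \<le> a * b \<Longrightarrow>
      power_moment d P c' \<le> power_moment d P c - (1 - cmod (c' j) * cmod (c' k) / (a * b)) * D"
    using power_moment_gap[OF P jk \<open>j \<noteq> k\<close>, of "a\<^sup>2 + b\<^sup>2" c "a * b"] ab sq by (auto simp: a_def b_def)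
  define T where "T = power_moment d P c"
  define L where "L = D * (a\<^sup>2 - b\<^sup>2) / (a * b)"
  have L: "0 < L" using D sq ab by (simp add: L_def)
  \<comment> \<open>The moment after rotation is at most \<open>T - L * (sin t * cos t)\<close> by
    the gap and at least \<open>cos t powr P * T\<close> by the Hilbert point property, so
    \<open>H t <= 0\<close> for small \<open>t > 0\<close>. But \<open>H 0 = 0\<close>, and the
    slope there is \<open>L > 0\<close>.\<close>
  define H where "H = (\<lambda>t. L * (sin t * cos t) - T * (1 - cos t powr P))"
  have H_le: "H t \<le> 0" if t: "0 < t" "0 < sin t" "0 < cos t" "0 < b * cos t - a * sin t" for t
  proof -
    \<comment> \<open>The rotation enlarges the larger modulus. The last condition on
      \<open>t\<close> keeps \<open>b'\<close> positive, so that it is again a modulus.\<close>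
    define a' b' where "a' = a * cos t + b * sin t" and "b' = b * cos t - a * sin t"
    have a'b': "0 \<le> a'" "0 \<le> b'" using t ab by (auto simp: a'_def b'_def)
    have sc: "(sin t)\<^sup>2 = 1 - (cos t)\<^sup>2" by (rule sin_squared_eq)
    have rot: "a'\<^sup>2 + b'\<^sup>2 = a\<^sup>2 + b\<^sup>2"
    proof -
      have "(a * x + b * y)\<^sup>2 + (b * x - a * y)\<^sup>2 = (a\<^sup>2 + b\<^sup>2) * (y\<^sup>2 + x\<^sup>2)" for x y
        by (simp add: power2_eq_square algebra_simps)
      then show ?thesis by (simp add: a'_def b'_def)
    qed
    have K': "a' * b' \<le> a * b - (a\<^sup>2 - b\<^sup>2) * (sin t * cos t)"
    proof -
      have "a' * b' = a * b * ((cos t)\<^sup>2 - (sin t)\<^sup>2) - (a\<^sup>2 - b\<^sup>2) * (sin t * cos t)"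
        unfolding a'_def b'_def by (simp add: power2_eq_square algebra_simps)
      moreover have "a * b * ((cos t)\<^sup>2 - (sin t)\<^sup>2) \<le> a * b * 1"
      proof (rule mult_left_mono)
        have "(cos t)\<^sup>2 \<le> 1" by (simp add: abs_square_le_1)
        then show "(cos t)\<^sup>2 - (sin t)\<^sup>2 \<le> 1" unfolding sc by linarith
      qed (use ab in simp)
      ultimately show ?thesis by simp
    qed
    \<comment> \<open>Real factors preserve the phases, so the inner product of the new coefficients
      with \<open>c\<close> is real and involves only moduli.\<close>
    define c' where "c' = c(j := of_real (a' / a) * c j, k := of_real (b' / b) * c k)"
    have c': "c' j = of_real (a' / a) * c j" "c' k = of_real (b' / b) * c k"
      "\<And>i. i \<noteq> j \<Longrightarrow> i \<noteq> k \<Longrightarrow> c' i = c i"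
      using \<open>j \<noteq> k\<close> by (auto simp: c'_def)
    have cm: "cmod (c' j) = a'" "cmod (c' k) = b'"
      unfolding c' norm_mult norm_of_real a_def[symmetric] b_def[symmetric] using ab a'b' by auto
    have upper: "power_moment d P c' \<le> T - L * (sin t * cos t)"
    proof -
      have "0 \<le> (a\<^sup>2 - b\<^sup>2) * (sin t * cos t)" using sq t by simp
      then have "power_moment d P c' \<le> T - (1 - a' * b' / (a * b)) * D"
        using gap[of c'] K' c'(3) by (auto simp: cm rot T_def)
      moreover have "L * (sin t * cos t) \<le> (1 - a' * b' / (a * b)) * D"
      proof -
        have "a' * b' / (a * b) \<le> (a * b - (a\<^sup>2 - b\<^sup>2) * (sin t * cos t)) / (a * b)"
          using K' ab by (intro divide_right_mono) auto
        also have "\<dots> = 1 - (a\<^sup>2 - b\<^sup>2) * (sin t * cos t) / (a * b)"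
          using ab by (simp add: diff_divide_distrib)
        finally have "(a\<^sup>2 - b\<^sup>2) * (sin t * cos t) / (a * b) * D \<le> (1 - a' * b' / (a * b)) * D"
          using D by (intro mult_right_mono) auto
        then show ?thesis by (simp add: L_def mult_ac)
      qed
      ultimately show ?thesis by simp
    qed
    define I where "I = {1..d} - {j, k}"
    have J: "{1..d} = insert j (insert k I)" and I: "finite I" "j \<notin> I" "k \<notin> I"
      using jk by (auto simp: I_def)
    define W where "W = (\<Sum>i\<in>I. (cmod (c i))\<^sup>2)"
    have W: "0 \<le> W" by (simp add: W_def sum_nonneg)
    have cc: "c i * cnj (c i) = of_real ((cmod (c i))\<^sup>2)" for i
      using complex_norm_square[of "c i"] by simp
    have self: "(\<Sum>i = 1..d. c i * cnj (c i)) = of_real (a\<^sup>2 + b\<^sup>2 + W)"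
      unfolding J using I \<open>j \<noteq> k\<close> by (simp add: cc W_def a_def b_def)
    have "(\<Sum>i\<in>I. c' i * cnj (c i)) = (\<Sum>i\<in>I. c i * cnj (c i))"
      by (rule sum.cong) (auto simp: I_def c'(3))
    moreover have "c' j * cnj (c j) = of_real (a' * a)" "c' k * cnj (c k) = of_real (b' * b)"
      unfolding c' mult.assoc cc a_def[symmetric] b_def[symmetric]
      using ab by (simp_all add: power2_eq_square)
    ultimately have cross: "(\<Sum>i = 1..d. c' i * cnj (c i)) = of_real (a' * a + b' * b + W)"
      unfolding J using I \<open>j \<noteq> k\<close> by (simp add: cc W_def)
    have cross_ge: "cos t * (a\<^sup>2 + b\<^sup>2 + W) \<le> a' * a + b' * b + W"
    proof -
      have "cos t * W \<le> 1 * W" using W by (intro mult_right_mono) auto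
      then show ?thesis by (simp add: a'_def b'_def power2_eq_square algebra_simps)
    qed
    have N: "0 < a\<^sup>2 + b\<^sup>2 + W" using ab W by (simp add: add_pos_nonneg)
    \<comment> \<open>Division by \<open>l\<close> restores the inner product with the form. Since
      \<open>a' * a + b' * b = (a\<^sup>2 + b\<^sup>2) * cos t\<close> and \<open>W\<close> is
      unchanged, \<open>l\<close> is at least \<open>cos t\<close>.\<close>
    define l where "l = (a' * a + b' * b + W) / (a\<^sup>2 + b\<^sup>2 + W)"
    have l: "cos t \<le> l" unfolding l_def using cross_ge N by (simp add: pos_le_divide_eq)
    then have l0: "0 < l" using t by simp
    have "(\<Sum>i = 1..d. of_real (1 / l) * c' i * cnj (c i)) = of_real (1 / l) * (\<Sum>i = 1..d. c' i * cnj (c i))"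
      by (simp only: sum_distrib_left mult.assoc)
    also have "\<dots> = of_real (1 / l * (a' * a + b' * b + W))" unfolding cross by simp
    also have "1 / l * (a' * a + b' * b + W) = a\<^sup>2 + b\<^sup>2 + W"
      using l0 N unfolding l_def by (simp add: field_simps)
    finally have "(\<Sum>i = 1..d. of_real (1 / l) * c' i * cnj (c i)) = (\<Sum>i = 1..d. c i * cnj (c i))"
      unfolding self .
    then have "T \<le> power_moment d P (\<lambda>i. of_real (1 / l) * c' i)"
      unfolding T_def using P hp
      by (intro Lp_norm_le_imp_power_moment_le hilbert_point_linear_form_le) auto
    also have "\<dots> = (1 / l) powr P * power_moment d P c'"
      using l0 by (intro power_moment_scale) simp
    finally have "l powr P * T \<le> l powr P * ((1 / l) powr P * power_moment d P c')"
      by (intro mult_left_mono) auto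
    also have "\<dots> = power_moment d P c'"
      using l0 by (simp add: powr_divide)
    finally have "l powr P * T \<le> power_moment d P c'" .
    moreover have "cos t powr P * T \<le> l powr P * T"
      using l t P power_moment_nonneg[of d P c] by (intro mult_right_mono powr_mono2) (auto simp: T_def)
    ultimately have "cos t powr P * T \<le> T - L * (sin t * cos t)" using upper by linarith
    then show ?thesis by (simp add: H_def algebra_simps)
  qed
  have "(H has_real_derivative L) (at 0)"
    unfolding H_def by (auto intro!: derivative_eq_intros)
  from DERIV_pos_inc_right[OF this L] obtain e where e: "0 < e" "\<And>h. 0 < h \<Longrightarrow> h < e \<Longrightarrow> H 0 < H h"
    by auto
  have "((\<lambda>t. b * cos t - a * sin t) \<longlongrightarrow> b * cos 0 - a * sin 0) (at_right 0)"
    by (intro tendsto_intros)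
  then have "\<forall>\<^sub>F t in at_right 0. 0 < b * cos t - a * sin t"
    by (rule order_tendstoD) (use ab in simp)
  moreover have "\<forall>\<^sub>F t in at_right 0. t \<in> {0<..<min e (pi / 2)}"
    by (rule eventually_at_right_real) (use e in simp)
  ultimately have "\<forall>\<^sub>F t in at_right 0. 0 < b * cos t - a * sin t \<and> t \<in> {0<..<min e (pi / 2)}"
    by (rule eventually_conj)
  then obtain t where t: "0 < b * cos t - a * sin t" "0 < t" "t < e" "t < pi / 2"
    using eventually_happens'[OF trivial_limit_at_right_real] by fastforce
  have "H t \<le> 0"
    by (rule H_le) (use t in \<open>auto intro: sin_gt_zero cos_gt_zero\<close>)
  moreover have "H 0 < H t" using e(2) t by simp
  moreover have "H 0 = 0" by (simp add: H_def)
  ultimately show False by simp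
qed

section \<open>The exponent infinity\<close>

lemma circle_half_plane_sets:
  "{z \<in> sphere 0 1. s < Re (c * z)} \<in> sets circle_measure"
proof -
  have "{z \<in> space circle_measure. s < Re (c * z)} \<in> sets circle_measure" by measurable
  then show ?thesis by simp
qed

text \<open>Were the arc null, the continuous function \<open>max 0 (Re (c * z) - s)\<close> would
  have integral 0 and hence vanish on the circle. At the conjugate phase of \<open>c\<close> it
  equals \<open>cmod c - s > 0\<close>.\<close>

lemma emeasure_circle_half_plane_pos:
  assumes "s < cmod c"
  shows "0 < emeasure circle_measure {z \<in> sphere 0 1. s < Re (c * z)}"
proof (rule ccontr)
  let ?A = "{z \<in> sphere 0 1. s < Re (c * z)}"
  assume "\<not> 0 < emeasure circle_measure ?A"
  then have "?A \<in> null_sets circle_measure"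
    using circle_half_plane_sets by (auto simp: null_sets_def)
  then have "AE z in circle_measure. z \<notin> ?A" by (rule AE_not_in)
  moreover have "AE z in circle_measure. z \<in> sphere 0 1" by (rule AE_I2) simp
  ultimately have ae: "AE z in circle_measure. max 0 (Re (c * z) - s) = 0" by eventually_elim auto
  have c: "continuous_on A (\<lambda>z. max 0 (Re (c * z) - s))" for A by (intro continuous_intros)
  have "(LINT z|circle_measure. max 0 (Re (c * z) - s)) = 0"
    using ae by (rule integral_eq_zero_AE)
  then have "integral {0..1} (\<lambda>t. max 0 (Re (c * cis (2 * pi * t)) - s)) = 0"
    unfolding integral_circle[OF c] .
  then have zero: "max 0 (Re (c * cis (2 * pi * t)) - s) = 0" if "t \<in> {0..1}" for t
    using that by (subst (asm) integral_eq_0_iff) (auto intro!: continuous_intros)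
  obtain v where v: "cmod v = 1" "c = of_real (cmod c) * v" using exists_unit_rotation by blast
  obtain t where t: "0 \<le> t" "t \<le> 1" "cnj v = cis (2 * pi * t)"
    using unit_eq_cis[of "cnj v"] v(1) by auto
  have "v * cnj v = 1" using complex_norm_square[of v] v(1) by simp
  then have "c * cnj v = of_real (cmod c)"
    by (metis v(2) mult.assoc mult.right_neutral)
  then have "Re (c * cis (2 * pi * t)) = cmod c" using t(3) by simp
  then show False using zero[of t] t assms by simp
qed

text \<open>The coordinates vary independently, so all terms \<open>c i * z i\<close> can be nearly
  aligned with the positive real axis at once, on a product of arcs of positive measure.\<close>

lemma Lp_norm_infinity_linear_form:
  "Lp_norm (torus d) \<infinity> (linear_form d c) = (\<Sum>i = 1..d. cmod (c i))"
proof -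
  let ?B = "\<Sum>i = 1..d. cmod (c i)"
  let ?E = "esssup (torus d) (\<lambda>z. ereal (cmod (linear_form d c z)))"
  have "?E \<le> ereal ?B"
  proof (rule esssup_I)
    show "(\<lambda>z. ereal (cmod (linear_form d c z))) \<in> borel_measurable (torus d)" by measurable
    show "AE z in torus d. ereal (cmod (linear_form d c z)) \<le> ereal ?B"
      by (rule AE_I2) (simp only: ereal_less_eq norm_linear_form_torus_le)
  qed
  moreover have "ereal ?B \<le> ?E"
  proof (rule ccontr)
    assume "\<not> ereal ?B \<le> ?E"
    then obtain x where x: "?E < ereal x" "ereal x < ereal ?B"
      using ereal_dense2[of ?E "ereal ?B"] by (auto simp: not_le)
    \<comment> \<open>Each of the \<open>d\<close> terms loses less than \<open>s\<close>, so the
      total loss is at most \<open>?B - x\<close>. The added 1 keeps the denominator positive when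
      \<open>d = 0\<close>.\<close>
    define s where "s = (?B - x) / (real d + 1)"
    have s: "0 < s" using x(2) by (simp add: s_def)
    have ds: "real d * s \<le> ?B - x"
    proof -
      have "real d * s \<le> (real d + 1) * s" using s by simp
      also have "\<dots> = ?B - x" by (simp add: s_def)
      finally show ?thesis .
    qed
    define A where "A = (\<lambda>i. {z \<in> sphere 0 1. cmod (c i) - s < Re (c i * z)})"
    have A_sets: "A i \<in> sets circle_measure" for i unfolding A_def by (rule circle_half_plane_sets)
    have "AE z in torus d. ereal (cmod (linear_form d c z)) \<le> ?E" by (rule esssup_AE)
    then have "AE z in torus d. z \<notin> PiE {1..d} A"
    proof eventually_elim
      fix z assume "ereal (cmod (linear_form d c z)) \<le> ?E"
      then have less: "cmod (linear_form d c z) < x" using x(1) by (metis ereal_less(2) less_ereal.simps(1) order.strict_trans1)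
      show "z \<notin> PiE {1..d} A"
      proof
        assume "z \<in> PiE {1..d} A"
        then have "z i \<in> A i" if "i \<in> {1..d}" for i using that by (rule PiE_mem)
        then have "(\<Sum>i = 1..d. cmod (c i) - s) \<le> (\<Sum>i = 1..d. Re (c i * z i))"
          by (intro sum_mono) (auto simp: A_def intro: less_imp_le)
        also have "\<dots> = Re (linear_form d c z)" by (simp add: linear_form_def)
        also have "\<dots> \<le> cmod (linear_form d c z)" by (rule complex_Re_le_cmod)
        finally have "?B - real d * s \<le> cmod (linear_form d c z)" by (simp add: sum_subtractf)
        then show False using less ds by linarith
      qed
    qed
    moreover have "PiE {1..d} A \<in> sets (torus d)"
      unfolding torus_def by (rule sets_PiM_I_finite) (auto intro: A_sets)
    ultimately have "emeasure (torus d) (PiE {1..d} A) = 0"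
      using AE_iff_null_sets by blast
    moreover have "emeasure (torus d) (PiE {1..d} A) = (\<Prod>i = 1..d. emeasure circle_measure (A i))"
      unfolding torus_def by (rule circle_prod.emeasure_PiM) (auto intro: A_sets)
    moreover have "emeasure circle_measure (A i) \<noteq> 0" for i
      using emeasure_circle_half_plane_pos[of "cmod (c i) - s" "c i"] s by (simp add: A_def)
    ultimately show False by (auto simp: prod_zero_iff)
  qed
  ultimately have "?E = ereal ?B" by (rule order.antisym)
  then show ?thesis by (simp add: Lp_norm_def)
qed

text \<open>Deleting \<open>c\<^sub>k\<close> and enlarging \<open>c\<^sub>j\<close> so that the inner product with the form is preserved
  decreases the sum of the moduli.\<close>

lemma hilbert_point_linear_form_not_less_infinity:
  assumes hp: "hilbert_point d \<infinity> (linear_form d c)"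
    and jk: "j \<in> {1..d}" "k \<in> {1..d}" and ck: "c k \<noteq> 0" and less: "cmod (c k) < cmod (c j)"
  shows False
proof -
  have "j \<noteq> k" using less by auto
  define a b where "a = cmod (c j)" and "b = cmod (c k)"
  have ab: "0 < b" "b < a" using ck less by (auto simp: a_def b_def)
  \<comment> \<open>The new modulus \<open>t * a\<close> equals \<open>a + b\<^sup>2 / a\<close>,
    which is below \<open>a + b\<close> because \<open>b < a\<close>.\<close>
  define t where "t = (a\<^sup>2 + b\<^sup>2) / a\<^sup>2"
  have t: "0 \<le> t" "t * a\<^sup>2 = a\<^sup>2 + b\<^sup>2" using ab by (auto simp: t_def)
  define I where "I = {1..d} - {j, k}"
  have J: "{1..d} = insert j (insert k I)" and I: "finite I" "j \<notin> I" "k \<notin> I"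
    using jk by (auto simp: I_def)
  define c' where "c' = c(j := of_real t * c j, k := 0)"
  have c': "c' j = of_real t * c j" "c' k = 0" and c'_I: "\<And>i. i \<in> I \<Longrightarrow> c' i = c i"
    using \<open>j \<noteq> k\<close> I by (auto simp: c'_def)
  have cc: "c i * cnj (c i) = of_real ((cmod (c i))\<^sup>2)" for i
    using complex_norm_square[of "c i"] by simp
  have "(\<Sum>i = 1..d. c' i * cnj (c i)) = (\<Sum>i = 1..d. c i * cnj (c i))"
  proof -
    have "c' j * cnj (c j) + c' k * cnj (c k) = of_real (t * a\<^sup>2)"
      unfolding c' mult.assoc cc a_def by simp
    also have "\<dots> = c j * cnj (c j) + c k * cnj (c k)"
      unfolding t(2) unfolding cc a_def b_def by simp
    finally show ?thesis
      unfolding J using I \<open>j \<noteq> k\<close> c'_I by simp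
  qed
  from hilbert_point_linear_form_le[OF _ hp this]
  have "(\<Sum>i = 1..d. cmod (c i)) \<le> (\<Sum>i = 1..d. cmod (c' i))"
    by (simp add: Lp_norm_infinity_linear_form)
  then have "a + b \<le> cmod (c' j) + cmod (c' k)"
    unfolding J using I \<open>j \<noteq> k\<close> c'_I by (simp add: a_def b_def)
  also have "\<dots> = t * a"
    unfolding c' norm_mult norm_of_real a_def[symmetric] using t by simp
  finally have "(a + b) * a \<le> t * a\<^sup>2"
    using ab by (simp add: power2_eq_square mult_right_mono flip: mult.assoc)
  then have "a * b \<le> b * b" unfolding t(2) by (simp add: power2_eq_square algebra_simps)
  then show False using ab by simp
qed

theorem theorem1p4:
  fixes p :: ereal and d :: nat and c :: "nat \<Rightarrow> complex"
  assumes "2 < p" and "d \<ge> 1"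
    and "hilbert_point d p (\<lambda>z. \<Sum>j = 1..d. c j * z j)"
  shows "\<forall>j\<in>{1..d}. \<forall>k\<in>{1..d}. c j \<noteq> 0 \<longrightarrow> c k \<noteq> 0 \<longrightarrow> cmod (c j) = cmod (c k)"
proof -
  have hp: "hilbert_point d p (linear_form d c)"
    using assms(3) by (simp add: linear_form_def[abs_def])
  have not_less: "\<not> cmod (c k) < cmod (c j)" if "j \<in> {1..d}" "k \<in> {1..d}" "c k \<noteq> 0" for j k
  proof (cases p)
    case (real P)
    then show ?thesis
      using hilbert_point_linear_form_not_less_finite[of P d c j k] assms(1) hp that by auto
  next
    case PInf
    then show ?thesis
      using hilbert_point_linear_form_not_less_infinity[of d c j k] hp that by auto
  qed (use assms(1) in auto)
  then show ?thesis by (metis linorder_neqE)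
qed

end
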